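(* Let $k$ be any fixed number field with at least one real place, let $n\ge 2$ and let $d\ge 4$ be even. Then there exists a form $f\in\mathbb{Q}[x_0,\dots,x_n]$ of degree $d$ which is a sum of two squares of forms over $\mathbb{R}$, but not a sum of squares of forms over $k$.
   Context: A form is a homogeneous polynomial. "Sum of squares of forms over $k$" means a finite sum of squares of forms in $k[x_0,\dots,x_n]$, and similarly for $\mathbb{R}$. *)

theory Defs
  imports Complex_Main "HOL-Library.Poly_Mapping"
begin

text \<open>
  Polynomials over \<open>'a\<close> in the countably many variables \<open>x\<^sub>0, x\<^sub>1, \<dots>\<close> are finitely supported
  functions from monomials (finitely supported exponent vectors) to coefficients; the ring
  structure is the convolution product of \<^theory>\<open>HOL-Library.Poly_Mapping\<close>.
\<close>

type_synonym 'a mpoly = "(nat \<Rightarrow>\<^sub>0 nat) \<Rightarrow>\<^sub>0 'a"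

definition monom_deg :: "(nat \<Rightarrow>\<^sub>0 nat) \<Rightarrow> nat"
  where "monom_deg m = (\<Sum>i\<in>Poly_Mapping.keys m. Poly_Mapping.lookup m i)"

text \<open>
  The variables are \<open>x\<^sub>0, \<dots>, x\<^sub>n\<close>, so there are \<open>n + 1\<close> of them.
  The zero polynomial counts as a form of every degree.
\<close>

definition form_of_degree :: "nat \<Rightarrow> nat \<Rightarrow> 'a::zero mpoly \<Rightarrow> bool"
  where "form_of_degree n d f \<longleftrightarrow>
    (\<forall>m\<in>Poly_Mapping.keys f. Poly_Mapping.keys m \<subseteq> {0..n} \<and> monom_deg m = d)"

definition form :: "nat \<Rightarrow> 'a::zero mpoly \<Rightarrow> bool"
  where "form n f \<longleftrightarrow> (\<exists>d. form_of_degree n d f)"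

definition sum_of_N_squares_of_forms :: "nat \<Rightarrow> nat \<Rightarrow> 'a::comm_ring_1 mpoly \<Rightarrow> bool"
  where "sum_of_N_squares_of_forms n N f \<longleftrightarrow>
    (\<exists>g :: nat \<Rightarrow> 'a mpoly. (\<forall>j<N. form n (g j)) \<and> f = (\<Sum>j<N. (g j)^2))"

definition sum_of_squares_of_forms :: "nat \<Rightarrow> 'a::comm_ring_1 mpoly \<Rightarrow> bool"
  where "sum_of_squares_of_forms n f \<longleftrightarrow> (\<exists>N. sum_of_N_squares_of_forms n N f)"

definition base_change :: "rat mpoly \<Rightarrow> 'a::field_char_0 mpoly"
  where "base_change f = Poly_Mapping.map of_rat f"

text \<open>
  A number field is a field of characteristic zero that is finite-dimensional over its prime
  field \<open>\<rat>\<close>, that is, spanned over \<open>\<rat>\<close> by a finite set.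
\<close>

definition number_field :: "'k::field_char_0 itself \<Rightarrow> bool"
  where "number_field _ \<longleftrightarrow>
    (\<exists>B :: 'k set. finite B \<and> module.span (\<lambda>(q::rat) x. of_rat q * x) B = UNIV)"

text \<open>Real places are given by the field embeddings into \<open>\<real>\<close>; injectivity is automatic.\<close>

definition real_embedding :: "('k::field \<Rightarrow> real) \<Rightarrow> bool"
  where "real_embedding \<sigma> \<longleftrightarrow> \<sigma> 1 = 1 \<and>
    (\<forall>x y. \<sigma> (x + y) = \<sigma> x + \<sigma> y) \<and> (\<forall>x y. \<sigma> (x * y) = \<sigma> x * \<sigma> y)"

definition has_real_place :: "'k::field itself \<Rightarrow> bool"
  where "has_real_place _ \<longleftrightarrow> (\<exists>\<sigma> :: 'k \<Rightarrow> real. real_embedding \<sigma>)"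

end

theory Submission
  imports Defs "HOL-Computational_Algebra.Primes" "HOL-Computational_Algebra.Polynomial"
begin

text \<open>
  The example is a product of four complex conjugate lines. For a rational \<open>u\<close> with \<open>0 < u < 2\<close> put
  \<open>M = 4u\<^sup>2\<close>, let \<open>a\<^sub>1, \<dots>, a\<^sub>4\<close> be the roots of \<open>t\<^sup>4 + 2Mt + 3M\<close>, and let \<open>q\<close> be the product of the four linear
  forms \<open>x + a\<^sub>iy + a\<^sub>i\<^sup>2z\<close>. This is a rational quartic form in three variables (\<open>quartic\<close>). No \<open>a\<^sub>i\<close> is real, so
  \<open>q\<close> is \<open>|l\<^sub>1|\<^sup>2|l\<^sub>2|\<^sup>2\<close> for two complex linear forms, and it is the sum of the squares of the real and the
  imaginary part of \<open>l\<^sub>1l\<^sub>2\<close> (\<open>quartic_sum_of_two_squares\<close>).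

  The line \<open>l\<^sub>1 = 0\<close> meets its conjugate in a real point \<open>P\<close>, and \<open>l\<^sub>2 = 0\<close> meets its conjugate in a real
  point \<open>Q\<close>. If \<open>q\<close> is a sum of squares of quadratic forms over a real field \<open>k\<close>, then each of them vanishes
  at \<open>P\<close> and \<open>Q\<close>. The coordinates of these points lie in \<open>k(\<rho>, \<surd>(u\<rho>))\<close>, where \<open>\<rho>\<close> is the positive root of
  \<open>\<rho>\<^sup>3 - 3\<rho> = u\<close> (essentially the resolvent cubic of the four \<open>a\<^sub>i\<close>), and \<open>P\<close>, \<open>Q\<close> are exchanged by
  changing the sign of the square root. The sum and the difference of the two vanishing conditions are
  therefore polynomials of degree at most two in \<open>\<rho>\<close> with coefficients in \<open>k\<close>. If the cubic has no root in
  \<open>k\<close>, then \<open>\<rho>\<close> has degree three over \<open>k\<close>, and these polynomials vanish identically; this forces the quadratic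
  form to be zero (\<open>quadric_vanishing_at_double_points\<close>), a contradiction. For larger \<open>d\<close> the form
  \<open>z\<^bsup>d-4\<^esup> q\<close> works: after setting \<open>z = 1\<close> and the variables beyond \<open>x, y, z\<close> to zero, the squares
  again come from polynomials of degree at most two in \<open>x\<close> and \<open>y\<close>, because leading terms of real squares
  cannot cancel.

  It remains to choose \<open>u\<close> for the given number field \<open>k\<close> (\<open>ex_cubic_without_root\<close>). Writing \<open>u = 2 cos \<phi>\<close>, the
  cubic is the equation for trisecting \<open>\<phi>\<close>. Let \<open>w = \<surd>-3\<close> and \<open>\<zeta>\<^sub>x = (x + w)/(x - w)\<close> for an integer \<open>x\<close>; this number
  has absolute value one. If the cubic for \<open>u = 2 Re \<zeta>\<^sub>x\<close> has a root in \<open>k \<subseteq> \<real>\<close>, then \<open>\<zeta>\<^sub>x\<close> has a cube root in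
  \<open>k(w)\<close>. By a Kummer argument, a finite extension of \<open>F = \<rat>(w)\<close> contains cube roots of only finitely many
  classes of \<open>F\<^sup>\<times>\<close> modulo cubes (\<open>finitely_many_cube_root_classes\<close>). Choose \<open>\<zeta>\<^sub>y\<close> in each class that is hit, and
  a prime \<open>p > 3\<close> that divides some \<open>x\<^sup>2 + 3\<close> exactly once but divides none of the numbers \<open>y\<^sup>2 + 3\<close>. Then
  \<open>\<zeta>\<^sub>x/\<zeta>\<^sub>y\<close> is not a cube in \<open>F\<close> (\<open>norm_one_elt_cube_inequivalent\<close>), so \<open>\<zeta>\<^sub>x\<close> lies in a new class.
\<close>

section \<open>Subfields and the degree of a cubic irrationality\<close>

definition is_subfield :: "'a::field set \<Rightarrow> bool"
  where "is_subfield K \<longleftrightarrow> 1 \<in> K \<and> (\<forall>x\<in>K. \<forall>y\<in>K. x - y \<in> K \<and> x * y \<in> K \<and> x / y \<in> K)"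

lemma is_subfieldD:
  assumes "is_subfield K"
  shows "0 \<in> K" "1 \<in> K" "x \<in> K \<Longrightarrow> y \<in> K \<Longrightarrow> x - y \<in> K" "x \<in> K \<Longrightarrow> y \<in> K \<Longrightarrow> x * y \<in> K"
    "x \<in> K \<Longrightarrow> y \<in> K \<Longrightarrow> x / y \<in> K" "x \<in> K \<Longrightarrow> - x \<in> K" "x \<in> K \<Longrightarrow> y \<in> K \<Longrightarrow> x + y \<in> K"
    "x \<in> K \<Longrightarrow> x ^ n \<in> K"
proof -
  show 1: "1 \<in> K" using assms by (simp add: is_subfield_def)
  have m: "\<And>x y. x \<in> K \<Longrightarrow> y \<in> K \<Longrightarrow> x - y \<in> K" using assms by (simp add: is_subfield_def)
  show z: "0 \<in> K" using m[OF 1 1] by simp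
  show um: "- x \<in> K" if "x \<in> K" for x using m[OF z that] by simp
  show "x + y \<in> K" if "x \<in> K" "y \<in> K" for x y using m[OF that(1) um[OF that(2)]] by simp
  show mu: "x * y \<in> K" if "x \<in> K" "y \<in> K" for x y using that assms by (simp add: is_subfield_def)
  show "x ^ n \<in> K" if "x \<in> K" for n using that 1 mu by (induction n) auto
qed (use assms in \<open>auto simp: is_subfield_def\<close>)

lemma is_subfield_of_nat: "is_subfield K \<Longrightarrow> of_nat n \<in> K"
  by (induction n) (auto intro: is_subfieldD)

lemma is_subfield_of_int: "is_subfield K \<Longrightarrow> of_int n \<in> K"
  by (cases n rule: int_diff_cases) (auto intro: is_subfieldD is_subfield_of_nat)

lemma is_subfield_of_rat: "is_subfield K \<Longrightarrow> of_rat q \<in> (K :: 'a::field_char_0 set)"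
  by (cases q) (auto simp: of_rat_rat intro: is_subfieldD is_subfield_of_int)

lemma is_subfield_numeral: "is_subfield K \<Longrightarrow> numeral n \<in> K"
  using is_subfield_of_nat[of K "numeral n"] by simp

lemmas subfield_intros = is_subfieldD is_subfield_numeral is_subfield_of_rat

text \<open>
  A cubic without a root in a field is irreducible over it. The proof divides the cubic by a hypothetical
  quadratic annihilator of \<open>\<rho>\<close>: either the remainder expresses \<open>\<rho>\<close> rationally, or the linear cofactor has a
  root in the field.
\<close>
lemma cubic_root_degree_three:
  fixes \<rho> u :: "'a::field_char_0"
  assumes K: "is_subfield K" and noroot: "\<forall>x\<in>K. x ^ 3 - 3 * x \<noteq> u"
    and u: "u \<in> K" and root: "\<rho> ^ 3 - 3 * \<rho> = u"
    and a: "a0 \<in> K" "a1 \<in> K" "a2 \<in> K" and eq: "a0 + a1 * \<rho> + a2 * \<rho> ^ 2 = 0"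
  shows "a0 = 0 \<and> a1 = 0 \<and> a2 = 0"
proof -
  have notin: "\<rho> \<notin> K" using noroot root by auto
  have a2: "a2 = 0"
  proof (rule ccontr)
    assume nz: "a2 \<noteq> 0"
    define v w where "v = - a1 / a2" and "w = - a0 / a2"
    have vw: "v \<in> K" "w \<in> K" unfolding v_def w_def using a by (auto intro!: subfield_intros[OF K])
    have sq: "\<rho> ^ 2 = v * \<rho> + w" using eq nz unfolding v_def w_def
      by (simp add: field_simps) algebra
    have "\<rho> ^ 3 = (v ^ 2 + w) * \<rho> + v * w"
      using sq by algebra
    with root have lin: "(v ^ 2 + w - 3) * \<rho> = u - v * w" by (simp add: algebra_simps)
    show False
    proof (cases "v ^ 2 + w - 3 = 0")
      case True
      \<comment> \<open>The three roots of the cubic sum to zero and two of them sum to \<open>v\<close>, so \<open>- v\<close> is the third.\<close>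
      have "(- v) ^ 3 - 3 * (- v) = u" 
      proof -
        have "u = v * w" using True lin by simp
        thus ?thesis using True by algebra
      qed
      with noroot is_subfieldD(6)[OF K vw(1)] show False by blast
    next
      case False
      hence "\<rho> = (u - v * w) / (v ^ 2 + w - 3)" using lin by (simp add: field_simps)
      also have "\<dots> \<in> K" using u vw by (auto intro!: subfield_intros[OF K])
      finally show False using notin by simp
    qed
  qed
  have a1: "a1 = 0"
  proof (rule ccontr)
    assume "a1 \<noteq> 0"
    hence "\<rho> = - a0 / a1" using eq a2 by (simp add: field_simps eq_neg_iff_add_eq_0)
    also have "\<dots> \<in> K" using a by (auto intro!: subfield_intros[OF K])
    finally show False using notin by simp
  qed
  show ?thesis using eq a1 a2 by simp
qed

section \<open>Cube roots in finite extensions\<close>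

definition adjoin_cube_root :: "'a::field set \<Rightarrow> 'a \<Rightarrow> 'a set"
  where "adjoin_cube_root K \<alpha> = {c0 + c1 * \<alpha> + c2 * \<alpha> ^ 2 |c0 c1 c2. c0 \<in> K \<and> c1 \<in> K \<and> c2 \<in> K}"

lemma adjoin_cube_rootI:
  "c0 \<in> K \<Longrightarrow> c1 \<in> K \<Longrightarrow> c2 \<in> K \<Longrightarrow> x = c0 + c1 * \<alpha> + c2 * \<alpha> ^ 2 \<Longrightarrow> x \<in> adjoin_cube_root K \<alpha>"
  unfolding adjoin_cube_root_def by blast

context
  fixes K :: "'a::field_char_0 set" and \<alpha> \<omega> :: 'a
  assumes K: "is_subfield K" and \<omega>: "\<omega> \<in> K" "\<omega> ^ 2 + \<omega> + 1 = 0"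
    and \<alpha>: "\<alpha> ^ 3 \<in> K" "\<alpha> \<notin> K"
begin

text \<open>
  The cube roots of \<open>\<alpha>\<^sup>3\<close> are \<open>\<alpha>\<close>, \<open>\<omega>\<alpha>\<close> and \<open>\<omega>\<^sup>2\<alpha>\<close>, and \<open>\<omega>\<close> lies in the field.
\<close>
lemma cube_not_cube_in_field:
  assumes "x \<in> K"
  shows "x ^ 3 \<noteq> \<alpha> ^ 3"
proof
  assume "x ^ 3 = \<alpha> ^ 3"
  hence "(\<alpha> - x) * ((\<alpha> - \<omega> * x) * (\<alpha> - \<omega> ^ 2 * x)) = 0"
    using \<omega>(2) by algebra
  hence "\<alpha> = x \<or> \<alpha> = \<omega> * x \<or> \<alpha> = \<omega> ^ 2 * x" by auto
  moreover have "\<omega> * x \<in> K" "\<omega> ^ 2 * x \<in> K" using assms \<omega> by (auto intro!: subfield_intros[OF K])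
  ultimately show False using assms \<alpha> by auto
qed

lemma cube_root_independent:
  assumes c: "c0 \<in> K" "c1 \<in> K" "c2 \<in> K" and eq: "c0 + c1 * \<alpha> + c2 * \<alpha> ^ 2 = 0"
  shows "c0 = 0 \<and> c1 = 0 \<and> c2 = 0"
proof -
  have c2: "c2 = 0"
  proof (rule ccontr)
    assume nz: "c2 \<noteq> 0"
    define u v where "u = - c1 / c2" and "v = - c0 / c2"
    have uv: "u \<in> K" "v \<in> K" unfolding u_def v_def using c by (auto intro!: subfield_intros[OF K])
    have sq: "\<alpha> ^ 2 = u * \<alpha> + v" using eq nz unfolding u_def v_def
      by (simp add: field_simps) algebra
    have lin: "(u ^ 2 + v) * \<alpha> = \<alpha> ^ 3 - u * v" using sq by algebra
    show False
    proof (cases "u ^ 2 + v = 0")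
      case True
      hence "(- u) ^ 3 = \<alpha> ^ 3" using lin by simp algebra
      with cube_not_cube_in_field[OF is_subfieldD(6)[OF K uv(1)]] show False by simp
    next
      case False
      hence "\<alpha> = (\<alpha> ^ 3 - u * v) / (u ^ 2 + v)" using lin by (simp add: field_simps)
      also have "\<dots> \<in> K" using \<alpha> uv by (auto intro!: subfield_intros[OF K])
      finally show False using \<alpha> by simp
    qed
  qed
  have c1: "c1 = 0"
  proof (rule ccontr)
    assume "c1 \<noteq> 0"
    hence "\<alpha> = - c0 / c1" using eq c2 by (simp add: field_simps eq_neg_iff_add_eq_0)
    also have "\<dots> \<in> K" using c by (auto intro!: subfield_intros[OF K])
    finally show False using \<alpha> by simp
  qed
  show ?thesis using eq c1 c2 by simp
qed

text \<open>
  Inverses are computed from the norm, the product of the three elements obtained by replacing \<open>\<alpha>\<close> with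
  \<open>\<alpha>\<close>, \<open>\<omega>\<alpha>\<close> and \<open>\<omega>\<^sup>2\<alpha>\<close>; none of them is zero because \<open>1, \<alpha>, \<alpha>\<^sup>2\<close> are linearly independent.
\<close>
lemma is_subfield_adjoin_cube_root: "is_subfield (adjoin_cube_root K \<alpha>)"
proof -
  let ?L = "adjoin_cube_root K \<alpha>"
  define a where "a = \<alpha> ^ 3"
  have a: "a \<in> K" using \<alpha> a_def by simp
  have mult: "x * y \<in> ?L" if xy: "x \<in> ?L" "y \<in> ?L" for x y
  proof -
    obtain c0 c1 c2 where x: "x = c0 + c1 * \<alpha> + c2 * \<alpha> ^ 2" and c: "c0 \<in> K" "c1 \<in> K" "c2 \<in> K"
      using xy unfolding adjoin_cube_root_def by auto
    obtain d0 d1 d2 where y: "y = d0 + d1 * \<alpha> + d2 * \<alpha> ^ 2" and d: "d0 \<in> K" "d1 \<in> K" "d2 \<in> K"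
      using xy unfolding adjoin_cube_root_def by auto
    show ?thesis
    proof (rule adjoin_cube_rootI)
      show "x * y = (c0 * d0 + a * (c1 * d2 + c2 * d1)) + (c0 * d1 + c1 * d0 + a * (c2 * d2)) * \<alpha>
          + (c0 * d2 + c1 * d1 + c2 * d0) * \<alpha> ^ 2"
        unfolding x y a_def by algebra
    qed (use a c d in \<open>auto intro!: subfield_intros[OF K]\<close>)
  qed
  have inv: "1 / x \<in> ?L" if xL: "x \<in> ?L" for x
  proof (cases "x = 0")
    case True
    then show ?thesis by (auto intro!: adjoin_cube_rootI[of 0 K 0 0] subfield_intros[OF K])
  next
    case False
    obtain c0 c1 c2 where x: "x = c0 + c1 * \<alpha> + c2 * \<alpha> ^ 2" and c: "c0 \<in> K" "c1 \<in> K" "c2 \<in> K"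
      using xL unfolding adjoin_cube_root_def by auto
    define x1 where "x1 = c0 + (c1 * \<omega>) * \<alpha> + (c2 * \<omega> ^ 2) * \<alpha> ^ 2"
    define x2 where "x2 = c0 + (c1 * \<omega> ^ 2) * \<alpha> + (c2 * \<omega>) * \<alpha> ^ 2"
    have om0: "\<omega> \<noteq> 0" using \<omega>(2) by auto
    have x12: "x1 \<in> ?L" "x2 \<in> ?L" unfolding x1_def x2_def adjoin_cube_root_def
      using c \<omega> by (auto intro!: exI subfield_intros[OF K])
    have nz: "x1 \<noteq> 0" "x2 \<noteq> 0"
    proof -
      show "x1 \<noteq> 0"
      proof
        assume "x1 = 0"
        hence "c0 = 0 \<and> c1 * \<omega> = 0 \<and> c2 * \<omega> ^ 2 = 0" unfolding x1_def using c \<omega>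
          by (intro cube_root_independent) (auto intro!: subfield_intros[OF K])
        thus False using om0 False x by simp
      qed
      show "x2 \<noteq> 0"
      proof
        assume "x2 = 0"
        hence "c0 = 0 \<and> c1 * \<omega> ^ 2 = 0 \<and> c2 * \<omega> = 0" unfolding x2_def using c \<omega>
          by (intro cube_root_independent) (auto intro!: subfield_intros[OF K])
        thus False using om0 False x by simp
      qed
    qed
    define N where "N = c0 ^ 3 + a * c1 ^ 3 + a ^ 2 * c2 ^ 3 - 3 * a * c0 * c1 * c2"
    have N: "x * (x1 * x2) = N"
      unfolding N_def x x1_def x2_def a_def using \<omega>(2) by algebra
    have "N \<in> K" unfolding N_def using a c by (auto intro!: subfield_intros[OF K])
    hence "1 / N \<in> ?L" by (intro adjoin_cube_rootI[of "1 / N" K 0 0]) (auto intro!: subfield_intros[OF K])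
    moreover have "1 / x = 1 / N * (x1 * x2)" using nz False by (simp add: N[symmetric])
    ultimately show ?thesis using mult x12 by metis
  qed
  show ?thesis unfolding is_subfield_def
  proof (intro conjI ballI)
    show "1 \<in> ?L" by (rule adjoin_cube_rootI[of 1 K 0 0]) (auto intro!: subfield_intros[OF K])
    fix x y assume xy: "x \<in> ?L" "y \<in> ?L"
    show "x * y \<in> ?L" using mult xy by blast
    show "x / y \<in> ?L" using mult[OF xy(1) inv[OF xy(2)]] by simp
    show "x - y \<in> ?L"
    proof -
      obtain c0 c1 c2 where x: "x = c0 + c1 * \<alpha> + c2 * \<alpha> ^ 2" and c: "c0 \<in> K" "c1 \<in> K" "c2 \<in> K"
        using xy unfolding adjoin_cube_root_def by auto
      obtain d0 d1 d2 where y: "y = d0 + d1 * \<alpha> + d2 * \<alpha> ^ 2" and d: "d0 \<in> K" "d1 \<in> K" "d2 \<in> K"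
        using xy unfolding adjoin_cube_root_def by auto
      show ?thesis
        by (rule adjoin_cube_rootI[of "c0 - d0" K "c1 - d1" "c2 - d2"])
           (use c d x y in \<open>auto intro!: subfield_intros[OF K] simp: algebra_simps\<close>)
    qed
  qed
qed

text \<open>
  The core of Kummer theory. An automorphism \<open>\<alpha> \<mapsto> \<omega>\<alpha>\<close> would multiply \<open>\<beta>\<close> by a cube root of unity and thus
  show that \<open>\<beta>\<close> is an eigenvector. Instead, the coefficients of \<open>\<alpha>\<close> and \<open>\<alpha>\<^sup>2\<close> in \<open>\<beta>\<^sup>3\<close> are compared: if no
  coefficient of \<open>\<beta>\<close> is zero, eliminating between the two equations makes \<open>\<alpha>\<^sup>3\<close> a cube in the field.
\<close>
lemma pure_cube_root_in_extension:
  assumes \<beta>: "\<beta> \<in> adjoin_cube_root K \<alpha>" "\<beta> ^ 3 \<in> K"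
  obtains c j where "c \<in> K" "j < 3" "\<beta> = c * \<alpha> ^ j"
proof -
  obtain c0 c1 c2 where b: "\<beta> = c0 + c1 * \<alpha> + c2 * \<alpha> ^ 2" and c: "c0 \<in> K" "c1 \<in> K" "c2 \<in> K"
    using \<beta> unfolding adjoin_cube_root_def by auto
  define a where "a = \<alpha> ^ 3"
  have a: "a \<in> K" "a \<noteq> 0" using \<alpha> is_subfieldD[OF K] a_def by auto
  have "(c0 ^ 3 + a * c1 ^ 3 + a ^ 2 * c2 ^ 3 + 6 * a * c0 * c1 * c2 - \<beta> ^ 3)
      + 3 * (c0 ^ 2 * c1 + a * c1 ^ 2 * c2 + a * c0 * c2 ^ 2) * \<alpha>
      + 3 * (c0 ^ 2 * c2 + c0 * c1 ^ 2 + a * c1 * c2 ^ 2) * \<alpha> ^ 2 = 0"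
    unfolding b a_def by algebra
  hence "3 * (c0 ^ 2 * c1 + a * c1 ^ 2 * c2 + a * c0 * c2 ^ 2) = 0
      \<and> 3 * (c0 ^ 2 * c2 + c0 * c1 ^ 2 + a * c1 * c2 ^ 2) = 0"
    using cube_root_independent a c \<beta>(2) by (smt (verit, ccfv_threshold) subfield_intros[OF K])
  hence E1: "c0 ^ 2 * c1 + a * c1 ^ 2 * c2 + a * c0 * c2 ^ 2 = 0"
    and E2: "c0 ^ 2 * c2 + c0 * c1 ^ 2 + a * c1 * c2 ^ 2 = 0" by (simp_all only: mult_eq_0_iff) auto
  consider "c1 = 0 \<and> c2 = 0" | "c0 = 0 \<and> c2 = 0" | "c0 = 0 \<and> c1 = 0" | "c0 \<noteq> 0 \<and> c1 \<noteq> 0 \<and> c2 \<noteq> 0"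
    using E1 E2 a(2) by (cases "c0 = 0"; cases "c1 = 0"; cases "c2 = 0") auto
  thus thesis
  proof cases
    case 1 thus ?thesis using that[of c0 0] b c by simp
  next
    case 2 thus ?thesis using that[of c1 1] b c by simp
  next
    case 3 thus ?thesis using that[of c2 2] b c by simp
  next
    case 4
    have "c1 * (c0 ^ 3 - a ^ 2 * c2 ^ 3) = 0" using E1 E2 by algebra
    hence "c0 ^ 3 = a ^ 2 * c2 ^ 3" using 4 by simp
    hence "(a * c2 / c0) ^ 3 = a" using 4 a by (simp add: field_simps power3_eq_cube power2_eq_square)
    moreover have "a * c2 / c0 \<in> K" using a c by (auto intro!: subfield_intros[OF K])
    ultimately show ?thesis using cube_not_cube_in_field a_def by blast
  qed
qed

end

lemma vector_space_of_rat: "vector_space (\<lambda>(q::rat) (x::'a::field_char_0). of_rat q * x)"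
  by unfold_locales (auto simp: algebra_simps of_rat_add of_rat_mult)

text \<open>
  Call an intermediate field small if the cube roots in it of elements of \<open>F\<close> fall into finitely many
  classes modulo \<open>F\<close>. Adjoining a cube root to a small field gives a small field, by the previous lemma,
  and enlarges the dimension over \<open>\<rat>\<close>. As the dimension of \<open>L\<close> is finite, some small field already contains
  every such cube root in \<open>L\<close>.
\<close>
lemma finitely_many_cube_root_classes:
  fixes F L :: "'a::field_char_0 set"
  assumes F: "is_subfield F" and L: "is_subfield L" "F \<subseteq> L"
    and \<omega>: "\<omega> \<in> F" "\<omega> ^ 2 + \<omega> + 1 = 0"
    and fin: "finite B" "L \<subseteq> module.span (\<lambda>(q::rat) x. of_rat q * x) B"
  shows "\<exists>T. finite T \<and> (\<forall>\<beta>\<in>L. \<beta> ^ 3 \<in> F \<longrightarrow> (\<exists>t\<in>T. \<exists>c\<in>F. \<beta> = t * c))"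
proof -
  interpret V: vector_space "\<lambda>(q::rat) (x::'a). of_rat q * x" by (rule vector_space_of_rat)
  define classes where "classes K \<longleftrightarrow> (\<exists>T. finite T \<and> (\<forall>\<beta>\<in>K. \<beta> ^ 3 \<in> F \<longrightarrow> (\<exists>t\<in>T. \<exists>c\<in>F. \<beta> = t * c)))" for K
  \<comment> \<open>The dimension is measured from below, by the sizes of independent sets.\<close>
  define good where "good m \<longleftrightarrow> (\<exists>K I. is_subfield K \<and> F \<subseteq> K \<and> K \<subseteq> L \<and> classes K \<and> I \<subseteq> K
     \<and> V.independent I \<and> finite I \<and> card I = m)" for m
  have sub: "V.subspace K" if "is_subfield K" for K
    using that by (auto simp: V.subspace_def intro: subfield_intros)
  have "classes F" unfolding classes_def by (rule exI[of _ "{1}"]) auto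
  hence good0: "good 0" unfolding good_def using F L by (intro exI[of _ F] exI[of _ "{}"]) (auto simp: V.independent_empty)
  have bound: "m \<le> card B" if "good m" for m
  proof -
    from that obtain K I where "K \<subseteq> L" "I \<subseteq> K" "V.independent I" "card I = m"
      unfolding good_def by blast
    thus ?thesis using V.independent_span_bound[OF fin(1), of I] fin(2) by auto
  qed
  obtain m where m: "good m" and mmax: "\<And>m'. good m' \<Longrightarrow> m' \<le> m"
    using Nat.ex_has_greatest_nat[of good 0 "card B"] good0 bound by auto
  from m obtain K I where KI: "is_subfield K" "F \<subseteq> K" "K \<subseteq> L" "classes K" "I \<subseteq> K"
     "V.independent I" "finite I" "card I = m" unfolding good_def by blast
  have "\<beta> \<in> K" if \<beta>: "\<beta> \<in> L" "\<beta> ^ 3 \<in> F" for \<beta>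
  proof (rule ccontr)
    assume nin: "\<beta> \<notin> K"
    have b3: "\<beta> ^ 3 \<in> K" using \<beta> KI by auto
    have om: "\<omega> \<in> K" using \<omega> KI by auto
    let ?K' = "adjoin_cube_root K \<beta>"
    have sf: "is_subfield ?K'" using is_subfield_adjoin_cube_root[OF KI(1) om \<omega>(2) b3 nin] .
    have KK': "K \<subseteq> ?K'" 
      using adjoin_cube_rootI[of _ K 0 0] is_subfieldD(1)[OF KI(1)] by auto
    have bK': "\<beta> \<in> ?K'" 
      using adjoin_cube_rootI[of 0 K 1 0] is_subfieldD(1,2)[OF KI(1)] by auto
    have K'L: "?K' \<subseteq> L" unfolding adjoin_cube_root_def using KI \<beta>
      by (auto intro!: subfield_intros[OF L(1)])
    obtain T where T: "finite T" "\<forall>\<beta>\<in>K. \<beta> ^ 3 \<in> F \<longrightarrow> (\<exists>t\<in>T. \<exists>c\<in>F. \<beta> = t * c)"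
      using KI unfolding classes_def by blast
    have "classes ?K'" unfolding classes_def
    proof (intro exI conjI ballI impI)
      show "finite ((\<lambda>(t, j). t * \<beta> ^ j) ` (T \<times> {..<3}))" using T by auto
      fix \<gamma> assume g: "\<gamma> \<in> ?K'" "\<gamma> ^ 3 \<in> F"
      then obtain c j where cj: "c \<in> K" "j < 3" "\<gamma> = c * \<beta> ^ j"
        using pure_cube_root_in_extension[OF KI(1) om \<omega>(2) b3 nin] KI(2) by blast
      have bnz: "\<beta> \<noteq> 0" using nin is_subfieldD[OF KI(1)] by auto
      have "c ^ 3 = \<gamma> ^ 3 / (\<beta> ^ 3) ^ j" using bnz cj(3)
        by (simp add: power_mult_distrib field_simps flip: power_mult)
      also have "\<dots> \<in> F" using g \<beta> by (auto intro!: subfield_intros[OF F])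
      finally obtain t d where "t \<in> T" "d \<in> F" "c = t * d" using T cj by blast
      thus "\<exists>t\<in>(\<lambda>(t, j). t * \<beta> ^ j) ` (T \<times> {..<3}). \<exists>c\<in>F. \<gamma> = t * c"
        using cj by (intro bexI[of _ "t * \<beta> ^ j"] bexI[of _ d]) auto
    qed
    moreover have "V.span I \<subseteq> K" using V.span_minimal[OF KI(5) sub[OF KI(1)]] .
    hence "V.independent (insert \<beta> I)" using KI(6) nin by (intro V.independent_insertI) auto
    moreover have "card (insert \<beta> I) = Suc m" using nin KI by (subst card_insert_disjoint) auto
    ultimately have "good (Suc m)" unfolding good_def using sf KK' K'L bK' KI
      by (intro exI[of _ ?K'] exI[of _ "insert \<beta> I"]) auto
    thus False using mmax by fastforce
  qed
  thus ?thesis using KI(4) unfolding classes_def by blast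
qed

section \<open>Elements of norm one in the field of cube roots of unity\<close>

definition sqrt_m3 :: complex where "sqrt_m3 = Complex 0 (sqrt 3)"

lemma sqrt_m3_sq: "sqrt_m3 ^ 2 = -3"
  by (simp add: sqrt_m3_def complex_eq_iff power2_eq_square)

lemma quad_Re_Im:
  "Re (of_real a + of_real b * sqrt_m3) = a" "Im (of_real a + of_real b * sqrt_m3) = b * sqrt 3"
  by (simp_all add: sqrt_m3_def)

definition quad_ext :: "real set \<Rightarrow> complex set"
  where "quad_ext S = {of_real a + of_real b * sqrt_m3 |a b. a \<in> S \<and> b \<in> S}"

lemma quad_extI: "a \<in> S \<Longrightarrow> b \<in> S \<Longrightarrow> x = of_real a + of_real b * sqrt_m3 \<Longrightarrow> x \<in> quad_ext S"
  unfolding quad_ext_def by blast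

lemma is_subfield_quad_ext:
  assumes S: "is_subfield S"
  shows "is_subfield (quad_ext S)"
proof -
  have mult: "x * y \<in> quad_ext S" if xy: "x \<in> quad_ext S" "y \<in> quad_ext S" for x y
  proof -
    obtain a b c d where ab: "x = of_real a + of_real b * sqrt_m3" "a \<in> S" "b \<in> S"
      and cd: "y = of_real c + of_real d * sqrt_m3" "c \<in> S" "d \<in> S"
      using xy unfolding quad_ext_def by blast
    show ?thesis
    proof (rule quad_extI)
      show "x * y = of_real (a * c - 3 * (b * d)) + of_real (a * d + b * c) * sqrt_m3"
        unfolding ab cd of_real_mult of_real_add of_real_diff of_real_numeral using sqrt_m3_sq by algebra
    qed (use ab cd in \<open>auto intro!: subfield_intros[OF S]\<close>)
  qed
  have inv: "1 / x \<in> quad_ext S" if x: "x \<in> quad_ext S" for x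
  proof -
    obtain a b where ab: "x = of_real a + of_real b * sqrt_m3" "a \<in> S" "b \<in> S"
      using x unfolding quad_ext_def by blast
    define N where "N = a ^ 2 + 3 * b ^ 2"
    show ?thesis
    proof (rule quad_extI)
      show "a / N \<in> S" "- b / N \<in> S" unfolding N_def using ab by (auto intro!: subfield_intros[OF S])
      show "1 / x = of_real (a / N) + of_real (- b / N) * sqrt_m3"
      proof (cases "N = 0")
        case True
        hence "a = 0" "b = 0" unfolding N_def by (auto simp: add_nonneg_eq_0_iff)
        thus ?thesis using ab by simp
      next
        case False
        have *: "x * (of_real a - of_real b * sqrt_m3) = of_real N"
          unfolding ab N_def of_real_add of_real_mult of_real_power of_real_numeral using sqrt_m3_sq by algebra
        have "x \<noteq> 0" using * False by auto
        thus ?thesis using * False by (simp add: field_simps)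
      qed
    qed
  qed
  show ?thesis unfolding is_subfield_def
  proof (intro conjI ballI)
    show "1 \<in> quad_ext S" by (rule quad_extI[of 1 S 0]) (auto intro!: subfield_intros[OF S])
    fix x y assume xy: "x \<in> quad_ext S" "y \<in> quad_ext S"
    show "x * y \<in> quad_ext S" using mult xy by blast
    show "x / y \<in> quad_ext S" using mult[OF xy(1) inv[OF xy(2)]] by simp
    obtain a b c d where ab: "x = of_real a + of_real b * sqrt_m3" "a \<in> S" "b \<in> S"
      and cd: "y = of_real c + of_real d * sqrt_m3" "c \<in> S" "d \<in> S"
      using xy unfolding quad_ext_def by blast
    show "x - y \<in> quad_ext S"
      by (rule quad_extI[of "a - c" S "b - d"])
        (use ab cd in \<open>auto intro!: subfield_intros[OF S] simp: algebra_simps\<close>)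
  qed
qed

definition p_integral :: "int \<Rightarrow> real \<Rightarrow> bool"
  where "p_integral p r \<longleftrightarrow> (\<exists>m n. \<not> p dvd n \<and> r * of_int n = of_int m)"

context
  fixes p :: int
  assumes p: "prime p"
begin

lemma p_integral_of_int: "p_integral p (of_int m)"
  unfolding p_integral_def using p by (intro exI[of _ m] exI[of _ 1]) (auto simp: not_prime_unit)

lemma p_integral_mult: "p_integral p r \<Longrightarrow> p_integral p s \<Longrightarrow> p_integral p (r * s)"
proof -
  assume "p_integral p r" "p_integral p s"
  then obtain m n m' n' where *: "\<not> p dvd n" "r * of_int n = of_int m" "\<not> p dvd n'" "s * of_int n' = of_int m'"
    unfolding p_integral_def by blast
  have "r * s * of_int (n * n') = (r * of_int n) * (s * of_int n')" by simp
  also have "\<dots> = of_int (m * m')" using * by simp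
  finally show ?thesis unfolding p_integral_def using * p by (meson prime_dvd_mult_iff)
qed

lemma p_integral_diff: "p_integral p r \<Longrightarrow> p_integral p s \<Longrightarrow> p_integral p (r - s)"
proof -
  assume "p_integral p r" "p_integral p s"
  then obtain m n m' n' where *: "\<not> p dvd n" "r * of_int n = of_int m" "\<not> p dvd n'" "s * of_int n' = of_int m'"
    unfolding p_integral_def by blast
  have "(r - s) * of_int (n * n') = (r * of_int n) * of_int n' - (s * of_int n') * of_int n"
    by (simp add: algebra_simps)
  also have "\<dots> = of_int (m * n' - m' * n)" using * by simp
  finally show ?thesis unfolding p_integral_def using * p by (meson prime_dvd_mult_iff)
qed

lemma p_integral_divide: "\<not> p dvd n \<Longrightarrow> p_integral p (of_int m / of_int n)"
  unfolding p_integral_def by (intro exI[of _ m] exI[of _ n]) auto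

lemma rat_lowest:
  assumes "r \<in> \<rat>"
  obtains A E :: int where "E \<noteq> 0" "coprime A E" "r = of_int A / of_int E"
proof -
  from assms obtain a b :: int where "b > 0" "coprime a b" "r = of_int a / of_int b"
    by (rule Rats_cases')
  thus thesis using that[of b a] by simp
qed

text \<open>
  If \<open>p\<close> divided the denominator of \<open>a\<close>, then \<open>p\<^sup>3\<close> would divide that of \<open>4a\<^sup>3 - 3a\<close>, while the hypothesis
  allows a single factor \<open>p\<close>. The polynomial is the real part of the cube of a number of absolute value one
  with real part \<open>a\<close>.
\<close>
lemma chebyshev_p_integral:
  assumes a: "a \<in> \<rat>" and p3: "p > 3" and M: "\<not> p dvd M"
    and eq: "of_int (p * M) * (4 * a ^ 3 - 3 * a) = of_int N"
  shows "p_integral p a"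
proof -
  from a obtain A E where AE: "E \<noteq> 0" "coprime A E" "a = of_int A / of_int E"
    by (rule rat_lowest)
  have "\<not> p dvd E"
  proof
    assume pE: "p dvd E"
    then obtain E' where E': "E = p * E'" by blast
    have p0: "p \<noteq> 0" using p by auto
    have "real_of_int (p * M * (4 * A ^ 3 - 3 * A * E ^ 2)) = real_of_int (p * M) * (4 * a ^ 3 - 3 * a) * of_int E ^ 3"
      using AE(1) unfolding AE(3) by (simp add: field_simps power2_eq_square power3_eq_cube)
    also have "\<dots> = real_of_int (N * E ^ 3)" unfolding eq by simp
    finally have "p * M * (4 * A ^ 3 - 3 * A * E ^ 2) = N * E ^ 3" by (simp only: of_int_eq_iff)
    also have "\<dots> = p * (p * (p * N * E' ^ 3))" unfolding E' by (simp add: power3_eq_cube)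
    finally have "M * (4 * A ^ 3 - 3 * A * E ^ 2) = p * (p * N * E' ^ 3)" using p0 by (simp add: mult.assoc)
    hence "p dvd M * (4 * A ^ 3 - 3 * A * E ^ 2)" by simp
    hence "p dvd 4 * A ^ 3 - 3 * A * E ^ 2" using M p prime_dvd_mult_iff by blast
    moreover have "p dvd 3 * A * E ^ 2" using pE by (simp add: power2_eq_square)
    ultimately have "p dvd (4 * A ^ 3 - 3 * A * E ^ 2) + 3 * A * E ^ 2" by (rule dvd_add)
    hence "p dvd 2 \<or> p dvd 2 \<or> p dvd A ^ 3"
      using prime_dvd_mult_iff[OF p, of "2 * 2" "A ^ 3"] prime_dvd_mult_iff[OF p, of 2 2] by simp
    moreover have "\<not> p dvd 2" using p3 zdvd_imp_le[of p 2] by auto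
    ultimately have "p dvd A" using p prime_dvd_power by blast
    thus False using AE(2) pE p by (meson coprime_common_divisor not_prime_unit)
  qed
  thus ?thesis unfolding AE(3) by (rule p_integral_divide)
qed

lemma p_integral_norm_one:
  assumes a: "p_integral p a" and b: "b \<in> \<rat>" and p3: "p > 3" and eq: "a ^ 2 + 3 * b ^ 2 = 1"
  shows "p_integral p b"
proof -
  from b obtain B D where BD: "D \<noteq> 0" "coprime B D" "b = of_int B / of_int D"
    by (rule rat_lowest)
  from a obtain m n where mn: "\<not> p dvd n" "a * of_int n = of_int m" unfolding p_integral_def by blast
  have "\<not> p dvd D"
  proof
    assume pD: "p dvd D"
    have b: "b * of_int D = of_int B" using BD by simp
    have "(a * of_int n) ^ 2 * of_int D ^ 2 + 3 * (b * of_int D) ^ 2 * of_int n ^ 2 = (of_int n ^ 2 * of_int D ^ 2 :: real)"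
      using eq by algebra
    hence "real_of_int (m ^ 2 * D ^ 2 + 3 * B ^ 2 * n ^ 2) = of_int (n ^ 2 * D ^ 2)"
      unfolding mn b by simp
    hence "3 * B ^ 2 * n ^ 2 = D * (D * (n ^ 2 - m ^ 2))"
      unfolding of_int_eq_iff by (simp add: algebra_simps power2_eq_square)
    hence "p dvd 3 * B ^ 2 * n ^ 2" using pD by simp
    moreover have "\<not> p dvd 3" using p3 zdvd_imp_le[of p 3] by auto
    ultimately have "p dvd B" using mn p prime_dvd_mult_iff prime_dvd_power by metis
    thus False using BD(2) pD p by (meson coprime_common_divisor not_prime_unit)
  qed
  thus ?thesis unfolding BD(3) by (rule p_integral_divide)
qed

end

definition norm_one_elt :: "int \<Rightarrow> complex"
  where "norm_one_elt x = (of_int x + sqrt_m3) / (of_int x - sqrt_m3)"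

lemma norm_one_elt_Re_Im:
  "norm_one_elt x = of_real (of_int (x ^ 2 - 3) / of_int (x ^ 2 + 3)) + of_real (of_int (2 * x) / of_int (x ^ 2 + 3)) * sqrt_m3"
proof -
  have X: "(of_int (x ^ 2 + 3) :: complex) \<noteq> 0" 
    unfolding of_int_eq_0_iff by (smt (verit) zero_le_power2)
  have *: "(of_int x - sqrt_m3) * (of_int x + sqrt_m3) = of_int (x ^ 2 + 3)"
    using sqrt_m3_sq by simp algebra
  hence nz: "of_int x - sqrt_m3 \<noteq> 0" using X by auto
  have "norm_one_elt x * of_int (x ^ 2 + 3) = (of_int x + sqrt_m3) ^ 2"
    unfolding *[symmetric] norm_one_elt_def using nz by (simp add: power2_eq_square)
  also have "\<dots> = of_int (x ^ 2 - 3) + of_int (2 * x) * sqrt_m3"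
    using sqrt_m3_sq by simp algebra
  finally have "norm_one_elt x = (of_int (x ^ 2 - 3) + of_int (2 * x) * sqrt_m3) / of_int (x ^ 2 + 3)"
    using X by (metis nonzero_eq_divide_eq)
  thus ?thesis by (simp add: add_divide_distrib del: of_int_add of_int_diff of_int_mult)
qed

lemma norm_one_elt_in: "is_subfield S \<Longrightarrow> norm_one_elt x \<in> quad_ext S"
  by (rule quad_extI[OF _ _ norm_one_elt_Re_Im]) (auto intro!: is_subfieldD is_subfield_of_int simp del: of_int_add of_int_diff of_int_mult)

lemma norm_norm_one_elt: "Re (norm_one_elt x) ^ 2 + Im (norm_one_elt x) ^ 2 = 1"
proof -
  have X: "(of_int x ^ 2 + 3 :: real) \<noteq> 0" by (smt (verit) zero_le_power2)
  show ?thesis unfolding norm_one_elt_Re_Im quad_Re_Im using X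
    by (simp add: power_mult_distrib divide_simps) algebra
qed

text \<open>
  The denominator of \<open>c\<^sup>3\<close>, the quotient of the two elements, contains \<open>p\<close> at most once, whereas a factor
  \<open>p\<close> in the denominator of \<open>c\<close> would occur in it three times. So \<open>c\<close> is \<open>p\<close>-integral, and then so is
  \<open>norm_one_elt x\<close>; but its real part \<open>(x\<^sup>2 - 3)/(x\<^sup>2 + 3)\<close> is not, since \<open>p\<close> does not divide \<open>6\<close>.
\<close>
lemma norm_one_elt_cube_inequivalent:
  assumes p: "prime p" "p > 3" and x: "p dvd x ^ 2 + 3" "\<not> p ^ 2 dvd x ^ 2 + 3" and y: "\<not> p dvd y ^ 2 + 3"
    and c: "c \<in> quad_ext \<rat>"
  shows "norm_one_elt x \<noteq> norm_one_elt y * c ^ 3"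
proof
  assume eq: "norm_one_elt x = norm_one_elt y * c ^ 3"
  obtain a b where ab: "a \<in> \<rat>" "b \<in> \<rat>" "c = of_real a + of_real b * sqrt_m3"
    using c unfolding quad_ext_def by blast
  have cm: "cmod (norm_one_elt z) = 1" for z using norm_norm_one_elt[of z] by (simp add: cmod_def)
  have "cmod c ^ 3 = 1" using arg_cong[OF eq, of cmod] cm by (simp add: norm_mult norm_power)
  hence "cmod c = 1" using power_eq_1_iff[of "cmod c" 3] by simp
  hence nrm: "a ^ 2 + 3 * b ^ 2 = 1" unfolding cmod_def ab(3) quad_Re_Im by (simp add: power_mult_distrib)
  have c3: "c ^ 3 = of_real (4 * a ^ 3 - 3 * a) + of_real (3 * b * (a ^ 2 - b ^ 2)) * sqrt_m3"
  proof -
    have "c ^ 3 = of_real (a ^ 3 - 9 * a * b ^ 2) + of_real (3 * b * (a ^ 2 - b ^ 2)) * sqrt_m3"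
      unfolding ab(3) of_real_mult of_real_add of_real_diff of_real_power of_real_numeral using sqrt_m3_sq by algebra
    also have "a ^ 3 - 9 * a * b ^ 2 = 4 * a ^ 3 - 3 * a" using nrm by algebra
    finally show ?thesis .
  qed
  define X Y where "X = x ^ 2 + 3" and "Y = y ^ 2 + 3"
  have XY: "X > 0" "Y > 0" unfolding X_def Y_def by (smt (verit) zero_le_power2)+
  obtain X' where X': "X = p * X'" using x X_def by blast
  have pX': "\<not> p dvd X'" using x(2) unfolding X_def[symmetric] X' power2_eq_square[of p] by (metis dvd_refl mult_dvd_mono)
  have YX: "\<not> p dvd Y * X'" using y pX' p prime_dvd_mult_iff Y_def by blast
  have "norm_one_elt x * cnj (norm_one_elt y) = c ^ 3 * (norm_one_elt y * cnj (norm_one_elt y))" unfolding eq by simp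
  also have "norm_one_elt y * cnj (norm_one_elt y) = 1" using cm[of y] by (simp add: complex_norm_square[symmetric])
  finally have "Re (c ^ 3) = Re (norm_one_elt x * cnj (norm_one_elt y))" by simp
  also have "\<dots> = Re (norm_one_elt x) * Re (norm_one_elt y) + Im (norm_one_elt x) * Im (norm_one_elt y)" by simp
  also have "\<dots> = (of_int (x ^ 2 - 3) / of_int X) * (of_int (y ^ 2 - 3) / of_int Y)
        + (of_int (2 * x) / of_int X) * (of_int (2 * y) / of_int Y) * 3"
    unfolding norm_one_elt_Re_Im quad_Re_Im X_def Y_def by (simp add: algebra_simps)
  also have "\<dots> = of_int ((x ^ 2 - 3) * (y ^ 2 - 3) + 12 * x * y) / of_int (X * Y)"
    using XY by (simp add: field_simps)
  finally have "of_int (X * Y) * (4 * a ^ 3 - 3 * a) = of_int ((x ^ 2 - 3) * (y ^ 2 - 3) + 12 * x * y)"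
    unfolding c3 quad_Re_Im using XY by (metis less_irrefl mult_pos_pos nonzero_mult_div_cancel_left of_int_eq_0_iff times_divide_eq_right)
  hence "of_int (p * (Y * X')) * (4 * a ^ 3 - 3 * a) = of_int ((x ^ 2 - 3) * (y ^ 2 - 3) + 12 * x * y)"
    unfolding X' by (simp only: mult_ac)
  hence pa: "p_integral p a" using chebyshev_p_integral[OF p(1) ab(1) p(2) YX] by blast
  have pb: "p_integral p b" using p_integral_norm_one[OF p(1) pa ab(2) p(2) nrm] .
  note pint = p_integral_mult[OF p(1)] p_integral_diff[OF p(1)]
  have num: "p_integral p (numeral k)" for k using p_integral_of_int[OF p(1), of "numeral k"] by simp
  have "Re (norm_one_elt x) = Re (norm_one_elt y) * Re (c ^ 3) - Im (norm_one_elt y) * Im (c ^ 3)"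
    unfolding eq by simp
  hence "of_int (x ^ 2 - 3) / of_int X = of_int (y ^ 2 - 3) / of_int Y * (4 * (a * (a * a)) - 3 * a)
      - of_int (2 * y) / of_int Y * (3 * (3 * (b * (a * a - b * b))))"
    unfolding c3 norm_one_elt_Re_Im quad_Re_Im X_def Y_def by (simp add: algebra_simps power2_eq_square power3_eq_cube)
  also have "p_integral p \<dots>"
    by (intro pint num pa pb p_integral_divide[OF p(1)] y[folded Y_def])
  finally obtain m n where mn: "\<not> p dvd n" "of_int (x ^ 2 - 3) / of_int X * of_int n = (of_int m :: real)"
    unfolding p_integral_def by blast
  hence "real_of_int ((x ^ 2 - 3) * n) = of_int (m * X)" using XY by (simp add: field_simps)
  hence "(x ^ 2 - 3) * n = m * X" by (simp only: of_int_eq_iff)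
  hence "p dvd (x ^ 2 - 3) * n" unfolding X' by simp
  hence "p dvd x ^ 2 - 3" using mn p prime_dvd_mult_iff by blast
  hence "p dvd (x ^ 2 + 3) - (x ^ 2 - 3)" using x dvd_diff by blast
  hence "p dvd 2 * 3" by simp
  hence "p dvd 2 \<or> p dvd 3" using p prime_dvd_mult_iff by blast
  thus False using zdvd_imp_le[of p 2] zdvd_imp_le[of p 3] p by auto
qed

text \<open>
  Starting from \<open>z = 6M\<close>, every prime factor \<open>p\<close> of \<open>(z\<^sup>2 + 3)/3 = 12M\<^sup>2 + 1\<close> is coprime to \<open>6M\<close>. If \<open>p\<^sup>2\<close> divides
  \<open>z\<^sup>2 + 3\<close>, then it does not divide \<open>(z + p)\<^sup>2 + 3\<close>, which differs by \<open>2zp\<close> modulo \<open>p\<^sup>2\<close>.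
\<close>
lemma ex_prime_exactly_dividing:
  assumes "M > (0::int)"
  shows "\<exists>p x. prime p \<and> p > 3 \<and> \<not> p dvd M \<and> x \<ge> 2 \<and> p dvd x ^ 2 + 3 \<and> \<not> p ^ 2 dvd x ^ 2 + 3"
proof -
  define z where "z = 6 * M"
  have "\<not> is_unit (12 * M ^ 2 + 1)" using assms by simp
  then obtain p where p: "prime p" "p dvd 12 * M ^ 2 + 1"
    using prime_factor_int[of "12 * M ^ 2 + 1"] assms by auto
  have pz: "\<not> p dvd z"
  proof
    assume "p dvd z"
    hence "p dvd 2 * M * z" by simp
    hence "p dvd 12 * M ^ 2" unfolding z_def by (simp add: power2_eq_square algebra_simps)
    hence "p dvd 1" using p(2) by (simp add: dvd_add_right_iff)
    thus False using p by (simp add: not_prime_unit)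
  qed
  hence pM: "\<not> p dvd M" unfolding z_def by (metis dvd_mult)
  have n2: "\<not> p dvd 2" using pz dvd_mult2[of p "2::int" "3 * M"] unfolding z_def by auto
  have n3: "\<not> p dvd 3" using pz dvd_mult2[of p "3::int" "2 * M"] unfolding z_def by auto
  have p3: "p > 3"
  proof -
    have "p \<noteq> 2" "p \<noteq> 3" using n2 n3 by auto
    thus ?thesis using prime_gt_1_int[OF p(1)] by linarith
  qed
  have "z ^ 2 + 3 = 3 * (12 * M ^ 2 + 1)" unfolding z_def by (simp add: power2_eq_square)
  hence pd: "p dvd z ^ 2 + 3" using p(2) by (metis dvd_mult)
  have z2: "z \<ge> 2" "z + p \<ge> 2" using assms p3 unfolding z_def by simp_all
  show ?thesis
  proof (cases "p ^ 2 dvd z ^ 2 + 3")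
    case False
    thus ?thesis using p(1) p3 pM pd z2 by blast
  next
    case True
    have e: "(z + p) ^ 2 + 3 = (z ^ 2 + 3) + (p ^ 2 + p * (2 * z))" by (simp add: power2_eq_square algebra_simps)
    have "\<not> p ^ 2 dvd (z + p) ^ 2 + 3"
    proof
      assume "p ^ 2 dvd (z + p) ^ 2 + 3"
      hence "p ^ 2 dvd p * (2 * z)" unfolding e using True by (metis dvd_add_right_iff dvd_refl)
      hence "p dvd 2 * z" using p(1) unfolding power2_eq_square dvd_mult_cancel_left by auto
      thus False using n2 pz p prime_dvd_mult_iff by blast
    qed
    moreover have "p dvd (z + p) ^ 2 + 3" unfolding e by (rule dvd_add[OF pd]) (simp add: power2_eq_square)
    ultimately have "prime p \<and> p > 3 \<and> \<not> p dvd M \<and> z + p \<ge> 2 \<and> p dvd (z + p) ^ 2 + 3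
        \<and> \<not> p ^ 2 dvd (z + p) ^ 2 + 3"
      using p(1) p3 pM z2(2) by (intro conjI)
    thus ?thesis by (intro exI)
  qed
qed

section \<open>A cubic without a root in a number field\<close>

lemma real_embeddingD:
  assumes "real_embedding \<sigma>"
  shows "\<sigma> 1 = 1" "\<sigma> (x + y) = \<sigma> x + \<sigma> y" "\<sigma> (x * y) = \<sigma> x * \<sigma> y" "\<sigma> 0 = 0"
    "\<sigma> (x - y) = \<sigma> x - \<sigma> y" "\<sigma> (x / y) = \<sigma> x / \<sigma> y" "\<sigma> (x ^ n) = \<sigma> x ^ n"
    "\<sigma> (of_nat n) = of_nat n" "\<sigma> (of_int i) = of_int i"
proof -
  show one: "\<sigma> 1 = 1" and add: "\<And>x y. \<sigma> (x + y) = \<sigma> x + \<sigma> y" and mult: "\<And>x y. \<sigma> (x * y) = \<sigma> x * \<sigma> y"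
    using assms unfolding real_embedding_def by auto
  show zero: "\<sigma> 0 = 0" using add[of 0 0] by simp
  show diff: "\<sigma> (x - y) = \<sigma> x - \<sigma> y" for x y using add[of "x - y" y] by simp
  have inv: "\<sigma> y * \<sigma> (1 / y) = 1" if "y \<noteq> 0" for y using mult[of y "1 / y"] that one by simp
  show "\<sigma> (x / y) = \<sigma> x / \<sigma> y"
  proof (cases "y = 0")
    case False
    hence "\<sigma> (x / y) * \<sigma> y = \<sigma> x" using mult[of "x / y" y] by simp
    moreover have "\<sigma> y \<noteq> 0" using inv[OF False] by auto
    ultimately show ?thesis by (simp add: field_simps)
  qed (simp add: zero)
  show "\<sigma> (x ^ n) = \<sigma> x ^ n" for n by (induction n) (simp_all add: one mult)
  show nat: "\<sigma> (of_nat n) = of_nat n" for n by (induction n) (simp_all add: zero one add)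
  show "\<sigma> (of_int i) = of_int i" by (cases i rule: int_diff_cases) (simp add: diff nat)
qed

lemma real_embedding_of_rat: "real_embedding \<sigma> \<Longrightarrow> \<sigma> (of_rat q) = of_rat q"
  by (cases q) (simp add: of_rat_rat real_embeddingD)

lemma is_subfield_range: "real_embedding \<sigma> \<Longrightarrow> is_subfield (range \<sigma>)"
  unfolding is_subfield_def using real_embeddingD by (smt (verit) rangeE rangeI)

lemma is_subfield_Rats: "is_subfield (\<rat> :: 'a::field_char_0 set)"
  unfolding is_subfield_def by auto

lemma quad_ext_finite_dimensional:
  assumes "number_field TYPE('k::field_char_0)" and \<sigma>: "real_embedding (\<sigma> :: 'k \<Rightarrow> real)"
  shows "\<exists>B. finite B \<and> quad_ext (range \<sigma>) \<subseteq> module.span (\<lambda>(q::rat) x. of_rat q * x) B"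
proof -
  interpret V: vector_space "\<lambda>(q::rat) (x::complex). of_rat q * x" by (rule vector_space_of_rat)
  interpret W: vector_space "\<lambda>(q::rat) (x::'k). of_rat q * x" by (rule vector_space_of_rat)
  from assms(1) obtain B :: "'k set" where B: "finite B" "W.span B = UNIV"
    unfolding number_field_def by blast
  define C where "C = (\<lambda>b. of_real (\<sigma> b)) ` B \<union> (\<lambda>b. of_real (\<sigma> b) * sqrt_m3) ` B"
  have re: "of_rat q = complex_of_real (of_rat q)" for q by (cases q) (simp add: of_rat_rat)
  have "W.span B \<subseteq> {x. of_real (\<sigma> x) \<in> V.span C \<and> of_real (\<sigma> x) * sqrt_m3 \<in> V.span C}"
  proof (rule W.span_minimal)
    show "B \<subseteq> {x. of_real (\<sigma> x) \<in> V.span C \<and> of_real (\<sigma> x) * sqrt_m3 \<in> V.span C}"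
      unfolding C_def by (auto intro!: V.span_base)
    show "W.subspace {x. of_real (\<sigma> x) \<in> V.span C \<and> of_real (\<sigma> x) * sqrt_m3 \<in> V.span C}"
      unfolding W.subspace_def
      by (auto simp: real_embeddingD[OF \<sigma>] real_embedding_of_rat[OF \<sigma>] distrib_right mult.assoc V.span_zero re[symmetric]
          intro: V.span_add V.span_scale)
  qed
  hence *: "of_real (\<sigma> x) \<in> V.span C" "of_real (\<sigma> x) * sqrt_m3 \<in> V.span C" for x unfolding B by auto
  have "quad_ext (range \<sigma>) \<subseteq> V.span C"
    unfolding quad_ext_def using * by (auto intro: V.span_add)
  moreover have "finite C" unfolding C_def using B by auto
  ultimately show ?thesis by blast
qed

text \<open>
  Twice the real part of \<open>norm_one_elt x\<close>.
\<close>
definition norm_one_trace :: "int \<Rightarrow> rat" where "norm_one_trace x = 2 * of_int (x ^ 2 - 3) / of_int (x ^ 2 + 3)"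

lemma norm_one_trace_bounds: assumes "x \<ge> 2" shows "0 < norm_one_trace x" "norm_one_trace x < 2"
proof -
  have "x ^ 2 \<ge> 2 ^ 2" using assms by (intro power_mono) auto
  hence "0 < x ^ 2 - 3" "0 < x ^ 2 + 3" by auto
  hence pos: "0 < (of_int (x ^ 2 - 3) :: rat)" "0 < (of_int (x ^ 2 + 3) :: rat)" by (simp_all only: of_int_0_less_iff)
  thus "0 < norm_one_trace x" unfolding norm_one_trace_def by simp
  show "norm_one_trace x < 2" unfolding norm_one_trace_def using pos(2) by (subst divide_less_eq) auto
qed

text \<open>
  With \<open>\<rho> = 2 cos (\<phi>/3)\<close> and \<open>norm_one_elt x = cos \<phi> + \<i> sin \<phi>\<close>, the cube root is \<open>cos (\<phi>/3) + \<i> sin (\<phi>/3)\<close>, and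
  \<open>sin (\<phi>/3)\<close> is rational in \<open>\<rho>\<close> and \<open>sin \<phi>\<close> because \<open>sin \<phi> = sin (\<phi>/3) (\<rho>\<^sup>2 - 1)\<close>.
\<close>
lemma trisection:
  assumes S: "is_subfield S" and \<rho>: "\<rho> \<in> S" and x: "x \<ge> 2" and root: "\<rho> ^ 3 - 3 * \<rho> = of_rat (norm_one_trace x)"
  obtains \<alpha> where "\<alpha> \<in> quad_ext S" "\<alpha> ^ 3 = norm_one_elt x"
proof -
  define c t :: real where "c = of_int (x ^ 2 - 3) / of_int (x ^ 2 + 3)" and "t = of_int (2 * x) / of_int (x ^ 2 + 3)"
  have u: "of_rat (norm_one_trace x) = 2 * c" unfolding c_def norm_one_trace_def
    by (simp add: of_rat_divide of_rat_mult of_rat_diff of_rat_add of_rat_power)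
  have unit: "norm_one_elt x = of_real c + of_real t * sqrt_m3" unfolding c_def t_def by (rule norm_one_elt_Re_Im)
  have ct: "c ^ 2 + 3 * t ^ 2 = 1"
    using norm_norm_one_elt[of x] unfolding unit quad_Re_Im by (simp add: power_mult_distrib)
  have "c < 1" using norm_one_trace_bounds(2)[OF x] u by (metis mult_less_cancel_left_disj of_rat_less of_rat_numeral_eq mult.right_neutral zero_less_numeral less_asym)
  moreover have "c > 0" using norm_one_trace_bounds(1)[OF x] u by (metis zero_less_of_rat_iff zero_less_mult_iff zero_less_numeral less_asym)
  ultimately have cb: "0 < c" "c < 1" by auto
  have root': "\<rho> ^ 3 - 3 * \<rho> = 2 * c" using root u by simp
  have r1: "\<rho> ^ 2 - 1 \<noteq> 0"
  proof
    assume "\<rho> ^ 2 - 1 = 0"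
    hence "\<rho> = 1 \<or> \<rho> = -1" by (simp add: power2_eq_1_iff)
    thus False using root' cb by auto
  qed
  define y where "y = t / (\<rho> ^ 2 - 1)"
  define \<alpha> where "\<alpha> = of_real (\<rho> / 2) + of_real y * sqrt_m3"
  have yt: "y * (\<rho> ^ 2 - 1) = t" unfolding y_def using r1 by simp
  have "(4 * (3 * y ^ 2) - (4 - \<rho> ^ 2)) * (\<rho> ^ 2 - 1) ^ 2 = 12 * (y * (\<rho> ^ 2 - 1)) ^ 2 - 4 + (\<rho> ^ 3 - 3 * \<rho>) ^ 2"
    by (simp add: power2_eq_square power3_eq_cube algebra_simps)
  also have "\<dots> = 4 * (c ^ 2 + 3 * t ^ 2) - 4" unfolding yt root' by (simp add: power_mult_distrib)
  finally have "(4 * (3 * y ^ 2) - (4 - \<rho> ^ 2)) * (\<rho> ^ 2 - 1) ^ 2 = 0" unfolding ct by simp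
  hence "4 * (3 * y ^ 2) - (4 - \<rho> ^ 2) = 0" using r1 by (simp only: mult_eq_0_iff power_eq_0_iff) simp
  hence y2: "3 * y ^ 2 = 1 - \<rho> ^ 2 / 4" by simp
  have "\<alpha> ^ 3 = of_real ((\<rho> / 2) ^ 3 - 9 * (\<rho> / 2) * y ^ 2) + of_real (3 * (\<rho> / 2) ^ 2 * y - 3 * y ^ 3) * sqrt_m3"
    unfolding \<alpha>_def of_real_mult of_real_add of_real_diff of_real_power of_real_numeral using sqrt_m3_sq by algebra
  also have "(\<rho> / 2) ^ 3 - 9 * (\<rho> / 2) * y ^ 2 = c"
  proof -
    have "(\<rho> / 2) ^ 3 - 9 * (\<rho> / 2) * y ^ 2 = (\<rho> ^ 3) / 8 - (3 * \<rho> / 2) * (3 * y ^ 2)" by (simp add: field_simps power3_eq_cube)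
    also have "\<dots> = c" unfolding y2 using root' by (simp add: field_simps power2_eq_square power3_eq_cube)
    finally show ?thesis .
  qed
  also have "3 * (\<rho> / 2) ^ 2 * y - 3 * y ^ 3 = t"
  proof -
    have "3 * (\<rho> / 2) ^ 2 * y - 3 * y ^ 3 = (3 * \<rho> ^ 2 / 4 - 3 * y ^ 2) * y" by (simp add: algebra_simps power2_eq_square power3_eq_cube)
    also have "\<dots> = y * (\<rho> ^ 2 - 1)" unfolding y2 by (simp add: algebra_simps)
    finally show ?thesis using yt by simp
  qed
  finally have "\<alpha> ^ 3 = norm_one_elt x" unfolding unit .
  moreover have "\<alpha> \<in> quad_ext S"
  proof (rule quad_extI)
    show "\<alpha> = of_real (\<rho> / 2) + of_real y * sqrt_m3" by (rule \<alpha>_def)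
    show "\<rho> / 2 \<in> S" "y \<in> S" unfolding y_def t_def
      using \<rho> by (auto intro!: is_subfieldD[OF S] is_subfield_numeral[OF S] is_subfield_of_int[OF S] simp del: of_int_add of_int_mult of_int_power)
  qed
  ultimately show thesis using that by blast
qed

text \<open>
  If every cubic in the family had a root, each class of cube roots that occurs could be given a
  representative \<open>y\<close>, and a prime avoiding all numbers \<open>y\<^sup>2 + 3\<close> would produce a member of yet another class.
\<close>
theorem ex_cubic_without_root:
  assumes nf: "number_field TYPE('k::field_char_0)" and \<sigma>: "real_embedding (\<sigma> :: 'k \<Rightarrow> real)"
  shows "\<exists>u::rat. 0 < u \<and> u < 2 \<and> (\<forall>r\<in>range \<sigma>. r ^ 3 - 3 * r \<noteq> of_rat u)"
proof (rule ccontr)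
  assume contra: "\<not> ?thesis"
  define S where "S = range \<sigma>"
  have S: "is_subfield S" unfolding S_def by (rule is_subfield_range[OF \<sigma>])
  define F L where "F = quad_ext \<rat>" and "L = quad_ext S"
  have F: "is_subfield F" and L: "is_subfield L"
    unfolding F_def L_def by (simp_all add: is_subfield_quad_ext is_subfield_Rats S)
  have "\<rat> \<subseteq> S" using is_subfield_of_rat[OF S] by (auto elim: Rats_cases)
  hence FL: "F \<subseteq> L" unfolding F_def L_def quad_ext_def by auto
  define \<omega> where "\<omega> = of_real (- 1 / 2) + of_real (1 / 2) * sqrt_m3"
  have "\<omega> \<in> F" unfolding F_def by (rule quad_extI[OF _ _ \<omega>_def]) auto
  moreover have "\<omega> ^ 2 + \<omega> + 1 = 0"
  proof -
    have "2 * \<omega> + 1 = sqrt_m3" unfolding \<omega>_def by simp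
    hence "(2 * \<omega> + 1) ^ 2 = - 3" using sqrt_m3_sq by simp
    hence "4 * (\<omega> ^ 2 + \<omega> + 1) = 0" by algebra
    thus ?thesis by (simp only: mult_eq_0_iff) simp
  qed
  moreover obtain B where "finite B" "L \<subseteq> module.span (\<lambda>(q::rat) x. of_rat q * x) B"
    using quad_ext_finite_dimensional[OF nf \<sigma>] unfolding L_def S_def by blast
  ultimately obtain T where T: "finite T" "\<forall>\<beta>\<in>L. \<beta> ^ 3 \<in> F \<longrightarrow> (\<exists>t\<in>T. \<exists>c\<in>F. \<beta> = t * c)"
    using finitely_many_cube_root_classes[OF F L FL, of \<omega> B] by blast
  have root: "\<exists>\<alpha> t c. \<alpha> ^ 3 = norm_one_elt x \<and> t \<in> T \<and> c \<in> F \<and> \<alpha> = t * c" if x: "x \<ge> 2" for x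
  proof -
    obtain r where "r \<in> S" "r ^ 3 - 3 * r = of_rat (norm_one_trace x)"
      using contra norm_one_trace_bounds[OF x] unfolding S_def by blast
    then obtain \<alpha> where "\<alpha> \<in> L" "\<alpha> ^ 3 = norm_one_elt x"
      using trisection[OF S _ x] unfolding L_def by blast
    moreover have "norm_one_elt x \<in> F" unfolding F_def by (rule norm_one_elt_in[OF is_subfield_Rats])
    ultimately show ?thesis using T by metis
  qed
  define good where "good t x \<longleftrightarrow> x \<ge> 2 \<and> (\<exists>c\<in>F. (t * c) ^ 3 = norm_one_elt x)" for t and x :: int
  \<comment> \<open>A class that contains no cube root gets the representative 0, whose factor 3 in \<open>M\<close> is harmless.\<close>
  define rep where "rep t = (if \<exists>x. good t x then SOME x. good t x else 0)" for t
  define M where "M = (\<Prod>t\<in>T. rep t ^ 2 + 3)"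
  have "M > 0" unfolding M_def by (intro prod_pos) (smt (verit) zero_le_power2)
  then obtain p x where px: "prime p" "p > 3" "\<not> p dvd M" "x \<ge> 2" "p dvd x ^ 2 + 3" "\<not> p ^ 2 dvd x ^ 2 + 3"
    using ex_prime_exactly_dividing by blast
  obtain t c where t: "t \<in> T" "c \<in> F" "(t * c) ^ 3 = norm_one_elt x" using root[OF px(4)] by metis
  hence ex: "\<exists>x. good t x" unfolding good_def using px by blast
  hence "good t (rep t)" unfolding rep_def by (simp add: someI_ex)
  then obtain d where d: "d \<in> F" "(t * d) ^ 3 = norm_one_elt (rep t)" unfolding good_def by blast
  have "rep t ^ 2 + 3 dvd M" unfolding M_def using t T by (intro dvd_prodI) auto
  hence nd: "\<not> p dvd rep t ^ 2 + 3" using px(3) dvd_trans by blast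
  have "norm_one_elt (rep t) \<noteq> 0" using norm_norm_one_elt[of "rep t"] by auto
  hence "d \<noteq> 0" using d by auto
  hence "norm_one_elt x = norm_one_elt (rep t) * (c / d) ^ 3"
    unfolding d(2)[symmetric] t(3)[symmetric] by (simp add: power_divide power_mult_distrib)
  moreover have "c / d \<in> quad_ext \<rat>" using is_subfieldD(5)[OF F t(2) d(1)] unfolding F_def .
  ultimately show False using norm_one_elt_cube_inequivalent[OF px(1,2,5,6) nd] by blast
qed

section \<open>Evaluation of polynomials and the grading\<close>

definition monom_eval :: "(nat \<Rightarrow> 'b::comm_ring_1) \<Rightarrow> (nat \<Rightarrow>\<^sub>0 nat) \<Rightarrow> 'b"
  where "monom_eval v m = (\<Prod>i\<in>Poly_Mapping.keys m. v i ^ Poly_Mapping.lookup m i)"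

definition mpoly_eval :: "('a \<Rightarrow> 'b) \<Rightarrow> (nat \<Rightarrow> 'b) \<Rightarrow> 'a::comm_ring_1 mpoly \<Rightarrow> 'b::comm_ring_1"
  where "mpoly_eval \<phi> v g = (\<Sum>m\<in>Poly_Mapping.keys g. \<phi> (Poly_Mapping.lookup g m) * monom_eval v m)"

lemma monom_eval_superset:
  assumes "finite A" "Poly_Mapping.keys m \<subseteq> A"
  shows "monom_eval v m = (\<Prod>i\<in>A. v i ^ Poly_Mapping.lookup m i)"
  unfolding monom_eval_def using assms by (intro prod.mono_neutral_left) (auto simp: in_keys_iff)

lemma monom_eval_add: "monom_eval v (m + m') = monom_eval v m * monom_eval v m'"
proof -
  define A where "A = Poly_Mapping.keys m \<union> Poly_Mapping.keys m' \<union> Poly_Mapping.keys (m + m')"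
  have "finite A" unfolding A_def by simp
  thus ?thesis using monom_eval_superset[of A _ v] unfolding A_def
    by (simp add: lookup_add power_add prod.distrib le_supI1 le_supI2)
qed

lemma monom_eval_single: "monom_eval v (Poly_Mapping.single i e) = v i ^ e"
  by (simp add: monom_eval_def)

lemma poly_mapping_sum_single:
  "(g :: 'a \<Rightarrow>\<^sub>0 'b::comm_monoid_add) = (\<Sum>m\<in>Poly_Mapping.keys g. Poly_Mapping.single m (Poly_Mapping.lookup g m))"
proof (rule poly_mapping_eqI)
  fix k
  show "Poly_Mapping.lookup g k = Poly_Mapping.lookup (\<Sum>m\<in>Poly_Mapping.keys g. Poly_Mapping.single m (Poly_Mapping.lookup g m)) k"
    unfolding lookup_sum lookup_single when_def
    by (cases "k \<in> Poly_Mapping.keys g") (auto simp: in_keys_iff)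
qed

context
  fixes \<phi> :: "'a::comm_ring_1 \<Rightarrow> 'b::comm_ring_1"
  assumes hom: "\<And>x y. \<phi> (x + y) = \<phi> x + \<phi> y" "\<And>x y. \<phi> (x * y) = \<phi> x * \<phi> y"
begin

lemma hom_zero: "\<phi> 0 = 0" using hom(1)[of 0 0] by simp

lemma mpoly_eval_superset:
  assumes "finite A" "Poly_Mapping.keys g \<subseteq> A"
  shows "mpoly_eval \<phi> v g = (\<Sum>m\<in>A. \<phi> (Poly_Mapping.lookup g m) * monom_eval v m)"
  unfolding mpoly_eval_def using assms
  by (intro sum.mono_neutral_left) (auto simp: in_keys_iff hom_zero)

lemma mpoly_eval_add: "mpoly_eval \<phi> v (g + g') = mpoly_eval \<phi> v g + mpoly_eval \<phi> v g'"
proof -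
  define A where "A = Poly_Mapping.keys g \<union> Poly_Mapping.keys g' \<union> Poly_Mapping.keys (g + g')"
  have "finite A" unfolding A_def by simp
  thus ?thesis using mpoly_eval_superset[of A _ v] unfolding A_def
    by (simp add: lookup_add hom sum.distrib le_supI1 le_supI2 distrib_right)
qed

lemma mpoly_eval_zero: "mpoly_eval \<phi> v 0 = 0"
  by (simp add: mpoly_eval_def)

lemma mpoly_eval_sum: "mpoly_eval \<phi> v (sum f I) = (\<Sum>i\<in>I. mpoly_eval \<phi> v (f i))"
  by (induction I rule: infinite_finite_induct) (simp_all add: mpoly_eval_add mpoly_eval_zero)

lemma mpoly_eval_single: "mpoly_eval \<phi> v (Poly_Mapping.single m c) = \<phi> c * monom_eval v m"
  by (simp add: mpoly_eval_def hom_zero)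

lemma mpoly_eval_mult: "mpoly_eval \<phi> v (g * h) = mpoly_eval \<phi> v g * mpoly_eval \<phi> v h"
proof -
  have "mpoly_eval \<phi> v (g * h) = mpoly_eval \<phi> v
     ((\<Sum>m\<in>Poly_Mapping.keys g. Poly_Mapping.single m (Poly_Mapping.lookup g m))
      * (\<Sum>m\<in>Poly_Mapping.keys h. Poly_Mapping.single m (Poly_Mapping.lookup h m)))"
    using poly_mapping_sum_single[of g] poly_mapping_sum_single[of h] by simp
  also have "\<dots> = mpoly_eval \<phi> v g * mpoly_eval \<phi> v h"
    unfolding sum_product mult_single mpoly_eval_sum mpoly_eval_single
    unfolding mpoly_eval_def sum_product hom(2) monom_eval_add by (simp add: mult_ac)
  finally show ?thesis .
qed

end

definition mon3 :: "nat \<Rightarrow> nat \<Rightarrow> nat \<Rightarrow> (nat \<Rightarrow>\<^sub>0 nat)"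
  where "mon3 a b c = Poly_Mapping.single 0 a + Poly_Mapping.single 1 b + Poly_Mapping.single 2 c"

lemma monom_eval_mon3: "monom_eval v (mon3 a b c) = v 0 ^ a * v 1 ^ b * v 2 ^ c"
  unfolding mon3_def by (simp add: monom_eval_add monom_eval_single)

lemma mon3_add: "mon3 a b c + mon3 a' b' c' = mon3 (a + a') (b + b') (c + c')"
  unfolding mon3_def by (simp add: single_add ac_simps)

lemma monom_deg_superset:
  assumes "finite A" "Poly_Mapping.keys m \<subseteq> A"
  shows "monom_deg m = (\<Sum>i\<in>A. Poly_Mapping.lookup m i)"
  unfolding monom_deg_def using assms by (intro sum.mono_neutral_left) (auto simp: in_keys_iff)

lemma monom_deg_add: "monom_deg (m + m') = monom_deg m + monom_deg m'"
proof -
  define A where "A = Poly_Mapping.keys m \<union> Poly_Mapping.keys m' \<union> Poly_Mapping.keys (m + m')"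
  have "finite A" unfolding A_def by simp
  thus ?thesis using monom_deg_superset[of A] unfolding A_def
    by (simp add: lookup_add sum.distrib le_supI1 le_supI2)
qed

lemma monom_deg_mon3: "monom_deg (mon3 a b c) = a + b + c"
  unfolding mon3_def monom_deg_add by (simp add: monom_deg_def)

lemma keys_mon3: "Poly_Mapping.keys (mon3 a b c) \<subseteq> {0..2}"
proof
  fix i assume "i \<in> Poly_Mapping.keys (mon3 a b c)"
  hence "Poly_Mapping.lookup (mon3 a b c) i \<noteq> 0" by (simp add: in_keys_iff)
  thus "i \<in> {0..2}" unfolding mon3_def lookup_add lookup_single when_def by (auto split: if_splits)
qed

lemma form_of_degree_single:
  "n \<ge> 2 \<Longrightarrow> a + b + c = d \<Longrightarrow> form_of_degree n d (Poly_Mapping.single (mon3 a b c) k)"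
  unfolding form_of_degree_def using keys_mon3[of a b c] by (auto simp: monom_deg_mon3)

lemma form_of_degree_add:
  "form_of_degree n d f \<Longrightarrow> form_of_degree n d g \<Longrightarrow> form_of_degree n d (f + g)"
  unfolding form_of_degree_def using keys_add[of f g] by blast

lemma form_of_degree_diff:
  "form_of_degree n d f \<Longrightarrow> form_of_degree n d g \<Longrightarrow> form_of_degree n d (f - g :: 'a::ab_group_add mpoly)"
  unfolding form_of_degree_def using keys_diff[of f g] by blast

lemma form_of_degree_mult:
  assumes "form_of_degree n d f" "form_of_degree n e g"
  shows "form_of_degree n (d + e) (f * g)"
  unfolding form_of_degree_def
proof
  fix m assume "m \<in> Poly_Mapping.keys (f * g)"
  then obtain a b where "m = a + b" "a \<in> Poly_Mapping.keys f" "b \<in> Poly_Mapping.keys g"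
    using keys_mult[of f g] by blast
  hence "Poly_Mapping.keys m \<subseteq> Poly_Mapping.keys a \<union> Poly_Mapping.keys b"
    "Poly_Mapping.keys a \<subseteq> {0..n}" "Poly_Mapping.keys b \<subseteq> {0..n}" "monom_deg m = d + e"
    using assms keys_add[of a b] unfolding form_of_degree_def by (auto simp: monom_deg_add)
  thus "Poly_Mapping.keys m \<subseteq> {0..n} \<and> monom_deg m = d + e" by blast
qed

lemma lookup_base_change: "Poly_Mapping.lookup (base_change f) m = of_rat (Poly_Mapping.lookup f m)"
  unfolding base_change_def by (simp add: Poly_Mapping.map.rep_eq when_def)

lemma base_change_add: "base_change (f + g) = base_change f + base_change g"
  by (rule poly_mapping_eqI) (simp add: lookup_base_change lookup_add of_rat_add)

lemma base_change_single: "base_change (Poly_Mapping.single m c) = Poly_Mapping.single m (of_rat c)"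
  by (rule poly_mapping_eqI) (simp add: lookup_base_change lookup_single when_def)

section \<open>The quartic form and its two squares over the reals\<close>

text \<open>
  The product of the linear forms \<open>x + a\<^sub>iy + a\<^sub>i\<^sup>2z\<close> over the roots \<open>a\<^sub>i\<close> of \<open>t\<^sup>4 + 2Mt + 3M\<close>, times \<open>z\<^sup>l\<close>, written
  out in monomials so that it makes sense over \<open>\<rat>\<close>.
\<close>
definition quartic :: "nat \<Rightarrow> 'a::comm_ring_1 \<Rightarrow> 'a mpoly"
  where "quartic l M =
    Poly_Mapping.single (mon3 4 0 l) 1
  + Poly_Mapping.single (mon3 2 1 (l + 1)) (6 * M)
  + Poly_Mapping.single (mon3 2 0 (l + 2)) (6 * M)
  + Poly_Mapping.single (mon3 1 3 l) (- 2 * M)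
  + Poly_Mapping.single (mon3 1 2 (l + 1)) (- 12 * M)
  + Poly_Mapping.single (mon3 1 0 (l + 3)) (4 * M ^ 2)
  + Poly_Mapping.single (mon3 0 4 l) (3 * M)
  + Poly_Mapping.single (mon3 0 1 (l + 3)) (- 6 * M ^ 2)
  + Poly_Mapping.single (mon3 0 0 (l + 4)) (9 * M ^ 2)"

lemma form_of_degree_quartic: "n \<ge> 2 \<Longrightarrow> form_of_degree n (l + 4) (quartic l M)"
  unfolding quartic_def by (intro form_of_degree_add form_of_degree_single) simp_all

lemma base_change_quartic: "base_change (quartic l M) = quartic l (of_rat M)"
  unfolding quartic_def base_change_add base_change_single
  by (simp add: of_rat_mult of_rat_power of_rat_minus)

definition quartic_fun :: "'a::comm_ring_1 \<Rightarrow> 'a \<Rightarrow> 'a \<Rightarrow> 'a \<Rightarrow> 'a"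
  where "quartic_fun M x y z = x ^ 4 + 6 * M * x ^ 2 * y * z + 6 * M * x ^ 2 * z ^ 2 - 2 * M * x * y ^ 3
    - 12 * M * x * y ^ 2 * z + 4 * M ^ 2 * x * z ^ 3 + 3 * M * y ^ 4 - 6 * M ^ 2 * y * z ^ 3 + 9 * M ^ 2 * z ^ 4"

text \<open>
  The hypotheses give \<open>t\<^sup>4 + 2Mt + 3M = (t\<^sup>2 - 2ht + p)(t\<^sup>2 + 2ht + p')\<close>. Each factor on the right is the
  product of the two linear forms that belong to the roots of one of these quadratics.
\<close>
lemma quartic_factorisation:
  fixes x y z h p p' M :: "'a::comm_ring_1"
  assumes "p + p' = 4 * h ^ 2" "h * (p - p') = M" "p * p' = 3 * M"
  shows "quartic_fun M x y z
    = (x ^ 2 + 2 * h * x * y + p * y ^ 2 + (p' - p) * x * z + 2 * h * p * y * z + p ^ 2 * z ^ 2)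
    * (x ^ 2 - 2 * h * x * y + p' * y ^ 2 + (p - p') * x * z - 2 * h * p' * y * z + p' ^ 2 * z ^ 2)"
proof -
  have p': "p' = 4 * h ^ 2 - p" and M: "M = h * (p - p')" using assms by (simp_all add: algebra_simps)
  have "(x ^ 2 + 2 * h * x * y + p * y ^ 2 + (p' - p) * x * z + 2 * h * p * y * z + p ^ 2 * z ^ 2)
    * (x ^ 2 - 2 * h * x * y + p' * y ^ 2 + (p - p') * x * z - 2 * h * p' * y * z + p' ^ 2 * z ^ 2)
    = x ^ 4 + 6 * M * x ^ 2 * y * z + 2 * (p * p') * x ^ 2 * z ^ 2 - 2 * M * x * y ^ 3
      - 4 * (p * p') * x * y ^ 2 * z + 4 * M ^ 2 * x * z ^ 3 + (p * p') * y ^ 4 - 2 * (p * p') * M * y * z ^ 3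
      + (p * p') ^ 2 * z ^ 4"
    unfolding M p' by (simp add: algebra_simps eval_nat_numeral)
  also have "\<dots> = quartic_fun M x y z"
    unfolding assms(3) quartic_fun_def by (simp add: algebra_simps eval_nat_numeral)
  finally show ?thesis by simp
qed

text \<open>
  The roots of \<open>t\<^sup>2 - 2ht + p\<close> are \<open>a = h \<plusminus> \<i>k\<close>, and the two squares are those of the real and the imaginary part
  of \<open>x + ay + a\<^sup>2z\<close>.
\<close>
lemma quadratic_norm:
  fixes x y z h p p' k :: "'a::comm_ring_1"
  assumes "p + p' = 4 * h ^ 2" "k ^ 2 = p - h ^ 2"
  shows "(x + h * y + (2 * h ^ 2 - p) * z) ^ 2 + (k * (y + 2 * h * z)) ^ 2
    = x ^ 2 + 2 * h * x * y + p * y ^ 2 + (p' - p) * x * z + 2 * h * p * y * z + p ^ 2 * z ^ 2"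
proof -
  have p': "p' = 4 * h ^ 2 - p" using assms by (simp add: algebra_simps)
  have "(x + h * y + (2 * h ^ 2 - p) * z) ^ 2 + (k * (y + 2 * h * z)) ^ 2
     = (x + h * y + (2 * h ^ 2 - p) * z) ^ 2 + k ^ 2 * (y + 2 * h * z) ^ 2"
    by (simp add: power_mult_distrib)
  thus ?thesis unfolding assms(2) p' by (simp add: algebra_simps eval_nat_numeral)
qed

definition const :: "'a::comm_ring_1 \<Rightarrow> 'a mpoly" where "const c = Poly_Mapping.single 0 c"

definition X :: "'a::comm_ring_1 mpoly" where "X = Poly_Mapping.single (mon3 1 0 0) 1"
definition Y :: "'a::comm_ring_1 mpoly" where "Y = Poly_Mapping.single (mon3 0 1 0) 1"
definition Z :: "'a::comm_ring_1 mpoly" where "Z = Poly_Mapping.single (mon3 0 0 1) 1"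

lemma mon3_zero: "mon3 0 0 0 = 0" by (simp add: mon3_def)

lemma const_hom: "const (a + b) = const a + const b" "const (a - b) = const a - const b"
  "const (a * b) = const a * const b" "const (a ^ n) = const a ^ n" "const (numeral k) = numeral k" "const 1 = 1"
  "const (- a) = - const a"
proof -
  show m: "const (a * b) = const a * const b" for a b :: 'a unfolding const_def by (simp add: mult_single)
  show one: "const 1 = 1" unfolding const_def by simp
  show "const (a ^ n) = const a ^ n" by (induction n) (simp_all add: m one)
qed (simp_all add: const_def single_add single_diff single_uminus)

lemma XYZ_power:
  "X ^ n = Poly_Mapping.single (mon3 n 0 0) 1" "Y ^ n = Poly_Mapping.single (mon3 0 n 0) 1"
  "Z ^ n = Poly_Mapping.single (mon3 0 0 n) 1"
  by (induction n) (simp_all add: mon3_zero X_def Y_def Z_def mult_single mon3_add)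

lemma single_mon3: "Poly_Mapping.single (mon3 a b c) k = const k * X ^ a * Y ^ b * Z ^ c"
  unfolding XYZ_power const_def mult_single mon3_zero[symmetric] mon3_add by simp

lemma quartic_eq_quartic_fun: "quartic l M = Z ^ l * quartic_fun (const M) X Y Z"
  unfolding quartic_def quartic_fun_def single_mon3 const_hom
  by (simp add: algebra_simps power_add eval_nat_numeral)

lemma form_of_degree_linear:
  assumes "n \<ge> 2"
  shows "form_of_degree n 1 (const a * X + const b * Y + const c * Z)"
proof -
  have "const a * X + const b * Y + const c * Z = Poly_Mapping.single (mon3 1 0 0) a + Poly_Mapping.single (mon3 0 1 0) b
      + Poly_Mapping.single (mon3 0 0 1) c"
    unfolding const_def X_def Y_def Z_def mult_single by simp
  thus ?thesis using assms by (auto intro!: form_of_degree_add form_of_degree_single)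
qed

text \<open>
  Both quadratic factors are sums of two squares of linear forms, and the product of two sums of two squares is
  again one by the identity of Brahmagupta. The even power of \<open>z\<close> is absorbed into the squares.
\<close>
lemma quartic_sum_of_two_squares:
  fixes h p p' k k' M :: "'a::comm_ring_1"
  assumes n: "n \<ge> 2" and rel: "p + p' = 4 * h ^ 2" "h * (p - p') = M" "p * p' = 3 * M"
    and k: "k ^ 2 = p - h ^ 2" "k' ^ 2 = p' - h ^ 2"
  shows "sum_of_N_squares_of_forms n 2 (quartic (2 * j) M)"
proof -
  define A where "A = const 1 * X + const h * Y + const (2 * h ^ 2 - p) * Z"
  define B where "B = const 0 * X + const k * Y + const (k * (2 * h)) * Z"
  define A' where "A' = const 1 * X + const (- h) * Y + const (2 * h ^ 2 - p') * Z"
  define B' where "B' = const 0 * X + const k' * Y + const (- (k' * (2 * h))) * Z"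
  have zero: "const 0 = (0 :: 'a mpoly)" by (simp add: const_def)
  have C: "const p + const p' = 4 * const h ^ 2" "const h * (const p - const p') = const M"
     "const p * const p' = 3 * const M" "const k ^ 2 = const p - const h ^ 2" "const k' ^ 2 = const p' - const h ^ 2"
    using arg_cong[OF rel(1), of const] arg_cong[OF rel(2), of const] arg_cong[OF rel(3), of const]
      arg_cong[OF k(1), of const] arg_cong[OF k(2), of const] by (simp_all only: const_hom)
  have N: "A ^ 2 + B ^ 2 = X ^ 2 + 2 * const h * X * Y + const p * Y ^ 2 + (const p' - const p) * X * Z
      + 2 * const h * const p * Y * Z + const p ^ 2 * Z ^ 2"
    using quadratic_norm[OF C(1,4), of X Y Z] unfolding A_def B_def const_hom zero by (simp add: algebra_simps)
  have C': "const p' + const p = 4 * (- const h) ^ 2" "const k' ^ 2 = const p' - (- const h) ^ 2"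
    using C by (simp_all add: add.commute)
  have N': "A' ^ 2 + B' ^ 2 = X ^ 2 - 2 * const h * X * Y + const p' * Y ^ 2 + (const p - const p') * X * Z
      - 2 * const h * const p' * Y * Z + const p' ^ 2 * Z ^ 2"
    using quadratic_norm[OF C', of X Y Z] unfolding A'_def B'_def const_hom zero by (simp add: algebra_simps)
  define g where "g i = Z ^ j * (if i = 0 then A * A' - B * B' else A * B' + A' * B)" for i :: nat
  have lin: "form_of_degree n 1 A" "form_of_degree n 1 B" "form_of_degree n 1 A'" "form_of_degree n 1 B'"
    unfolding A_def B_def A'_def B'_def by (rule form_of_degree_linear[OF n])+
  have zj: "form_of_degree n j (Z ^ j :: 'a mpoly)"
    unfolding XYZ_power by (rule form_of_degree_single[OF n]) simp
  have "form_of_degree n (1 + 1) (A * A' - B * B')" "form_of_degree n (1 + 1) (A * B' + A' * B)"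
    by (rule form_of_degree_diff form_of_degree_add; rule form_of_degree_mult; rule lin)+
  hence "form_of_degree n (j + (1 + 1)) (g i)" for i
    unfolding g_def by (cases "i = 0") (simp_all only: if_True if_False simp_thms form_of_degree_mult[OF zj])
  hence forms: "\<forall>i<2. form n (g i)" unfolding form_def by blast
  have "quartic (2 * j) M = (\<Sum>i<2. g i ^ 2)"
  proof -
    have "quartic (2 * j) M = (Z ^ j) ^ 2 * ((A ^ 2 + B ^ 2) * (A' ^ 2 + B' ^ 2))"
      unfolding quartic_eq_quartic_fun quartic_factorisation[OF C(1-3)] N N' by (simp add: power_mult[symmetric] mult.commute)
    also have "\<dots> = g 0 ^ 2 + g 1 ^ 2"
      unfolding g_def by (simp add: algebra_simps power2_eq_square)
    finally show ?thesis by (simp add: numeral_2_eq_2)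
  qed
  with forms show ?thesis unfolding sum_of_N_squares_of_forms_def by blast
qed

text \<open>
  The two points with \<open>z = 1\<close> in which a line meets its complex conjugate.
\<close>
lemma quartic_fun_double_points:
  fixes h p p' M :: "'a::comm_ring_1"
  assumes rel: "p + p' = 4 * h ^ 2" "h * (p - p') = M" "p * p' = 3 * M"
  shows "quartic_fun M p (- 2 * h) 1 = 0" "quartic_fun M p' (2 * h) 1 = 0"
proof -
  have "p ^ 2 + 2 * h * p * (- 2 * h) + p * (- 2 * h) ^ 2 + (p' - p) * p * 1 + 2 * h * p * (- 2 * h) * 1 + p ^ 2 * 1 ^ 2
      = p * ((p + p') - 4 * h ^ 2)"
    by (simp add: algebra_simps power2_eq_square)
  thus "quartic_fun M p (- 2 * h) 1 = 0" unfolding quartic_factorisation[OF rel] rel(1) by simp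
  have "p' ^ 2 - 2 * h * p' * (2 * h) + p' * (2 * h) ^ 2 + (p - p') * p' * 1 - 2 * h * p' * (2 * h) * 1 + p' ^ 2 * 1 ^ 2
      = p' * ((p + p') - 4 * h ^ 2)"
    by (simp add: algebra_simps power2_eq_square)
  thus "quartic_fun M p' (2 * h) 1 = 0" unfolding quartic_factorisation[OF rel] rel(1) by simp
qed

text \<open>
  The factorisation of \<open>t\<^sup>4 + 2Mt + 3M\<close> with \<open>M = 4u\<^sup>2\<close> into real quadratics, obtained from the root \<open>\<rho>\<close> by
  \<open>h\<^sup>2 = u\<rho>\<close> and \<open>p, p' = 2h\<^sup>2 \<plusminus> M/(2h)\<close>. The last two inequalities say that neither quadratic has two distinct
  real roots; they amount to \<open>4u \<le> \<rho>\<^sup>3 = 3\<rho> + u\<close>, which is why a root \<open>\<rho> \<ge> u\<close> is taken.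
\<close>
lemma real_data:
  fixes u :: real
  assumes u: "0 < u" "u < 2"
  obtains \<rho> h p p' where "\<rho> > 0" "\<rho> ^ 3 - 3 * \<rho> = u" "h ^ 2 = u * \<rho>" "h > 0"
    "p + p' = 4 * h ^ 2" "h * (p - p') = 4 * u ^ 2" "p * p' = 3 * (4 * u ^ 2)"
    "p - h ^ 2 \<ge> 0" "p' - h ^ 2 \<ge> 0"
proof -
  have "\<exists>\<rho>. u \<le> \<rho> \<and> \<rho> \<le> 2 \<and> \<rho> ^ 3 - 3 * \<rho> = u"
  proof (rule IVT)
    have "u * (u * u) \<le> u * (2 * 2)" using u by (intro mult_left_mono mult_mono) auto
    thus "u ^ 3 - 3 * u \<le> u" by (simp add: power3_eq_cube)
  qed (use u in \<open>auto intro!: continuous_intros\<close>)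
  then obtain \<rho> where \<rho>: "u \<le> \<rho>" "\<rho> ^ 3 - 3 * \<rho> = u" by blast
  have pos: "\<rho> > 0" using \<rho> u by linarith
  define h where "h = sqrt (u * \<rho>)"
  have h: "h ^ 2 = u * \<rho>" "h > 0" unfolding h_def using u pos by auto
  define p p' where "p = 2 * h ^ 2 + 2 * u ^ 2 / h" and "p' = 2 * h ^ 2 - 2 * u ^ 2 / h"
  have "p * p' = 4 * (h ^ 2) ^ 2 - 4 * u ^ 4 / h ^ 2"
    unfolding p_def p'_def by (simp add: algebra_simps power2_eq_square eval_nat_numeral)
  also have "\<dots> = 4 * u ^ 2 * (\<rho> ^ 3 - u) / \<rho>"
    unfolding h(1) using u pos by (simp add: field_simps eval_nat_numeral)
  also have "\<rho> ^ 3 - u = 3 * \<rho>" using \<rho> by simp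
  finally have pp': "p * p' = 3 * (4 * u ^ 2)" using pos by simp
  have "4 * u ^ 4 \<le> (h ^ 2) ^ 3"
  proof -
    have "4 * u \<le> \<rho> ^ 3" using \<rho> by linarith
    hence "u ^ 3 * (4 * u) \<le> u ^ 3 * \<rho> ^ 3" using u by (intro mult_left_mono) auto
    thus ?thesis unfolding h(1) by (simp add: power_mult_distrib eval_nat_numeral mult_ac)
  qed
  hence "(2 * u ^ 2) ^ 2 \<le> (h ^ 3) ^ 2" by (simp add: power_mult_distrib flip: power_mult)
  hence "2 * u ^ 2 \<le> h ^ 3" by (rule power2_le_imp_le) (use h in auto)
  hence small: "2 * u ^ 2 / h \<le> h ^ 2" using h by (simp add: field_simps eval_nat_numeral)
  have nonneg: "0 \<le> 2 * u ^ 2 / h" "0 \<le> h ^ 2" using h(2) by simp_all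
  show thesis
  proof (rule that[of \<rho> h p p'])
    show "p + p' = 4 * h ^ 2" unfolding p_def p'_def by simp
    show "h * (p - p') = 4 * u ^ 2" unfolding p_def p'_def using h by simp
    show "p - h ^ 2 \<ge> 0" "p' - h ^ 2 \<ge> 0" unfolding p_def p'_def using small nonneg by linarith+
  qed (use pos \<rho> h pp' in auto)
qed

section \<open>Quadratic polynomials vanishing at the two real points\<close>

text \<open>
  The two points are exchanged by \<open>h \<mapsto> - h\<close>. Hence the sum of the two equations and \<open>h\<close> times their difference
  involve \<open>h\<close> only through \<open>h\<^sup>2 = u\<rho>\<close>, and become relations of degree two for \<open>\<rho>\<close> over \<open>S\<close>. All their
  coefficients vanish, as \<open>\<rho>\<close> has degree three over \<open>S\<close>.
\<close>
lemma quadric_vanishing_at_double_points: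
  fixes u \<rho> h p p' :: real
  assumes S: "is_subfield S" and noroot: "\<forall>x\<in>S. x ^ 3 - 3 * x \<noteq> u" and u: "u \<in> S" "u \<noteq> 0"
    and root: "\<rho> ^ 3 - 3 * \<rho> = u"
    and rel: "h ^ 2 = u * \<rho>" "p + p' = 4 * h ^ 2" "h * (p - p') = 4 * u ^ 2" "p * p' = 3 * (4 * u ^ 2)"
    and coeffs: "\<alpha> \<in> S" "\<beta> \<in> S" "\<gamma> \<in> S" "\<delta> \<in> S" "\<epsilon> \<in> S" "\<zeta> \<in> S"
    and P: "\<alpha> + \<beta> * p + \<gamma> * (- 2 * h) + \<delta> * p ^ 2 + \<epsilon> * p * (- 2 * h) + \<zeta> * (- 2 * h) ^ 2 = 0"
    and Q: "\<alpha> + \<beta> * p' + \<gamma> * (2 * h) + \<delta> * p' ^ 2 + \<epsilon> * p' * (2 * h) + \<zeta> * (2 * h) ^ 2 = 0"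
  shows "\<alpha> = 0 \<and> \<beta> = 0 \<and> \<gamma> = 0 \<and> \<delta> = 0 \<and> \<epsilon> = 0 \<and> \<zeta> = 0"
proof -
  note SI = is_subfieldD[OF S] is_subfield_numeral[OF S]
  have sq: "p ^ 2 + p' ^ 2 = 16 * (u * \<rho>) ^ 2 - 24 * u ^ 2"
  proof -
    have "p ^ 2 + p' ^ 2 = (p + p') ^ 2 - 2 * (p * p')" by (simp add: power2_eq_square algebra_simps)
    thus ?thesis unfolding rel(2,4) rel(1) by (simp add: power_mult_distrib)
  qed
  have "0 = 2 * \<alpha> + \<beta> * (p + p') + \<delta> * (p ^ 2 + p' ^ 2) - 2 * \<epsilon> * (h * (p - p')) + 8 * \<zeta> * h ^ 2"
    using P Q by (simp add: algebra_simps power2_eq_square)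
  also have "\<dots> = (2 * \<alpha> - 24 * u ^ 2 * \<delta> - 8 * u ^ 2 * \<epsilon>) + (4 * u * (\<beta> + 2 * \<zeta>)) * \<rho> + (16 * u ^ 2 * \<delta>) * \<rho> ^ 2"
    unfolding sq rel(2,3) rel(1) by (simp add: algebra_simps power2_eq_square)
  finally have "2 * \<alpha> - 24 * u ^ 2 * \<delta> - 8 * u ^ 2 * \<epsilon> = 0 \<and> 4 * u * (\<beta> + 2 * \<zeta>) = 0 \<and> 16 * u ^ 2 * \<delta> = 0"
    by (intro cubic_root_degree_three[OF S noroot u(1) root]) (use coeffs u in \<open>auto intro!: SI\<close>)
  hence \<delta>: "\<delta> = 0" and e1: "\<beta> + 2 * \<zeta> = 0" and e2: "2 * \<alpha> = 8 * u ^ 2 * \<epsilon>" using u by auto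
  have "0 = \<beta> * (h * (p - p')) - 4 * \<gamma> * h ^ 2 - 2 * \<epsilon> * h ^ 2 * (p + p')"
  proof -
    have "h * ((\<alpha> + \<beta> * p + \<gamma> * (- 2 * h) + \<delta> * p ^ 2 + \<epsilon> * p * (- 2 * h) + \<zeta> * (- 2 * h) ^ 2)
      - (\<alpha> + \<beta> * p' + \<gamma> * (2 * h) + \<delta> * p' ^ 2 + \<epsilon> * p' * (2 * h) + \<zeta> * (2 * h) ^ 2)) = 0"
      unfolding P Q by simp
    thus ?thesis unfolding \<delta> by (simp add: algebra_simps power2_eq_square)
  qed
  also have "\<dots> = 4 * u ^ 2 * \<beta> + (- 4 * u * \<gamma>) * \<rho> + (- 8 * u ^ 2 * \<epsilon>) * \<rho> ^ 2"
    unfolding rel(2,3) rel(1) by (simp add: algebra_simps power2_eq_square)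
  finally have "4 * u ^ 2 * \<beta> = 0 \<and> - 4 * u * \<gamma> = 0 \<and> - 8 * u ^ 2 * \<epsilon> = 0"
    by (intro cubic_root_degree_three[OF S noroot u(1) root]) (use coeffs u in \<open>auto intro!: SI\<close>)
  thus ?thesis using \<delta> e1 e2 u by auto
qed

section \<open>Sums of squares over the number field\<close>

lemma coeff_square_top:
  fixes g :: "real poly"
  assumes "degree g \<le> E"
  shows "coeff (g ^ 2) (2 * E) = coeff g E ^ 2"
proof (cases "degree g = E")
  case True
  thus ?thesis using coeff_mult_degree_sum[of g g] by (simp add: power2_eq_square mult_2)
next
  case False
  hence "degree g < E" using assms by simp
  moreover have "degree (g ^ 2) < 2 * E" using \<open>degree g < E\<close> degree_mult_le[of g g] by (simp add: power2_eq_square)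
  ultimately show ?thesis by (simp add: coeff_eq_0)
qed

text \<open>
  The coefficient of the sum at twice the largest degree is a sum of squares of real leading coefficients,
  so it is positive.
\<close>
lemma degree_sum_of_squares:
  fixes g :: "nat \<Rightarrow> real poly"
  assumes deg: "degree (\<Sum>j<N. g j ^ 2) \<le> 2 * D" and j: "j < N"
  shows "degree (g j) \<le> D"
proof (rule ccontr)
  assume "\<not> degree (g j) \<le> D"
  define E where "E = Max ((\<lambda>j. degree (g j)) ` {..<N})"
  have le: "degree (g i) \<le> E" if "i < N" for i unfolding E_def using that by (intro Max_ge) auto
  have "E \<in> (\<lambda>j. degree (g j)) ` {..<N}" unfolding E_def using j by (intro Max_in) auto
  then obtain i where i: "i < N" "degree (g i) = E" by auto
  have ED: "E > D" using le[OF j] \<open>\<not> degree (g j) \<le> D\<close> by simp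
  hence "g i \<noteq> 0" using i by auto
  hence "coeff (g i) E ^ 2 > 0" using i by auto
  also have "coeff (g i) E ^ 2 \<le> (\<Sum>j<N. coeff (g j) E ^ 2)"
    using i by (intro member_le_sum) auto
  also have "\<dots> = coeff (\<Sum>j<N. g j ^ 2) (2 * E)"
    unfolding coeff_sum using le by (intro sum.cong refl coeff_square_top[symmetric]) auto
  also have "\<dots> = 0" using deg ED by (intro coeff_eq_0) simp
  finally show False by simp
qed

text \<open>
  Evaluating a form at \<open>ray a b\<close> restricts it to the points \<open>(ta, tb, 1, 0, \<dots>, 0)\<close> and gives a polynomial in
  \<open>t\<close>. The degree in \<open>t\<close> bounds the total degree in \<open>x\<close> and \<open>y\<close>.
\<close>
definition ray :: "real \<Rightarrow> real \<Rightarrow> nat \<Rightarrow> real poly"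
  where "ray a b i = (if i = 0 then monom a 1 else if i = 1 then monom b 1 else if i = 2 then 1 else 0)"

lemma monom_eval_ray:
  "monom_eval (ray a b) m = (if Poly_Mapping.keys m \<subseteq> {0, 1, 2}
     then monom (a ^ Poly_Mapping.lookup m 0 * b ^ Poly_Mapping.lookup m 1)
       (Poly_Mapping.lookup m 0 + Poly_Mapping.lookup m 1) else 0)"
proof (cases "Poly_Mapping.keys m \<subseteq> {0, 1, 2}")
  case True
  hence "monom_eval (ray a b) m = (\<Prod>i\<in>{0, 1, 2}. ray a b i ^ Poly_Mapping.lookup m i)"
    by (intro monom_eval_superset) auto
  thus ?thesis using True by (simp add: ray_def monom_power mult_monom)
next
  case False
  then obtain i where i: "i \<in> Poly_Mapping.keys m" "i \<notin> {0, 1, 2}" by blast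
  hence "monom_eval (ray a b) m = 0" unfolding monom_eval_def
    using i by (intro prod_zero bexI[of _ i]) (auto simp: ray_def in_keys_iff)
  thus ?thesis using False by simp
qed

text \<open>
  The terms of degree at most two of \<open>G\<close>, as a polynomial in \<open>x = ta\<close> and \<open>y = tb\<close>, have coefficients in
  \<open>S\<close> that are independent of the direction \<open>(a, b)\<close>. Terms of higher degree are not constrained.
\<close>
definition quadratic_along_rays :: "real set \<Rightarrow> (real \<Rightarrow> real \<Rightarrow> real poly) \<Rightarrow> bool"
  where "quadratic_along_rays S G \<longleftrightarrow> (\<exists>c :: nat \<Rightarrow> real. (\<forall>i. c i \<in> S) \<and> (\<forall>a b. coeff (G a b) 0 = c 0
      \<and> coeff (G a b) 1 = c 1 * a + c 2 * b \<and> coeff (G a b) 2 = c 3 * a ^ 2 + c 4 * a * b + c 5 * b ^ 2))"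

context
  fixes S :: "real set"
  assumes S: "is_subfield S"
begin

lemma quadratic_along_rays_zero: "quadratic_along_rays S (\<lambda>a b. 0)"
  unfolding quadratic_along_rays_def by (rule exI[of _ "\<lambda>_. 0"]) (simp add: is_subfieldD(1)[OF S])

lemma quadratic_along_rays_add:
  assumes "quadratic_along_rays S G" "quadratic_along_rays S H"
  shows "quadratic_along_rays S (\<lambda>a b. G a b + H a b)"
proof -
  obtain c :: "nat \<Rightarrow> real" where c: "\<forall>i. c i \<in> S" and cG: "\<forall>a b. coeff (G a b) 0 = c 0
    \<and> coeff (G a b) 1 = c 1 * a + c 2 * b \<and> coeff (G a b) 2 = c 3 * a ^ 2 + c 4 * a * b + c 5 * b ^ 2"
    using assms(1) unfolding quadratic_along_rays_def by (elim exE conjE)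
  obtain c' :: "nat \<Rightarrow> real" where c': "\<forall>i. c' i \<in> S" and cH: "\<forall>a b. coeff (H a b) 0 = c' 0
    \<and> coeff (H a b) 1 = c' 1 * a + c' 2 * b \<and> coeff (H a b) 2 = c' 3 * a ^ 2 + c' 4 * a * b + c' 5 * b ^ 2"
    using assms(2) unfolding quadratic_along_rays_def by (elim exE conjE)
  show ?thesis unfolding quadratic_along_rays_def coeff_add
  proof (intro exI conjI allI)
    show "c i + c' i \<in> S" for i using is_subfieldD(7)[OF S] c c' by simp
  qed (simp_all only: cG[rule_format] cH[rule_format], simp_all add: algebra_simps)
qed

lemma quadratic_along_rays_sum:
  "finite A \<Longrightarrow> (\<And>m. m \<in> A \<Longrightarrow> quadratic_along_rays S (G m)) \<Longrightarrow> quadratic_along_rays S (\<lambda>a b. \<Sum>m\<in>A. G m a b)"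
  by (induction A rule: finite_induct) (simp_all add: quadratic_along_rays_zero quadratic_along_rays_add)

lemma quadratic_along_rays_monom:
  assumes "s \<in> S"
  shows "quadratic_along_rays S (\<lambda>a b. monom (s * (a ^ i * b ^ j)) (i + j))"
proof -
  define c where "c l = (if l = 0 \<and> i = 0 \<and> j = 0 \<or> l = 1 \<and> i = 1 \<and> j = 0 \<or> l = 2 \<and> i = 0 \<and> j = 1
    \<or> l = 3 \<and> i = 2 \<and> j = 0 \<or> l = 4 \<and> i = 1 \<and> j = 1 \<or> l = 5 \<and> i = 0 \<and> j = 2 then s else 0)" for l :: nat
  have cases: "i = 0 \<or> i = 1 \<or> i = 2 \<or> i > 2" "j = 0 \<or> j = 1 \<or> j = 2 \<or> j > 2" by linarith+
  have coeffs: "coeff (monom (s * (a ^ i * b ^ j)) (i + j)) 0 = c 0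
      \<and> coeff (monom (s * (a ^ i * b ^ j)) (i + j)) 1 = c 1 * a + c 2 * b
      \<and> coeff (monom (s * (a ^ i * b ^ j)) (i + j)) 2 = c 3 * a ^ 2 + c 4 * a * b + c 5 * b ^ 2" for a b
    using cases by (elim disjE) (simp_all add: c_def)
  have "c l \<in> S" for l unfolding c_def using is_subfieldD(1)[OF S] assms by simp
  thus ?thesis unfolding quadratic_along_rays_def by (intro exI[of _ c]) (simp only: coeffs simp_thms)
qed

end

lemma quadratic_along_rays_mpoly_eval:
  assumes \<sigma>: "real_embedding \<sigma>"
  shows "quadratic_along_rays (range \<sigma>) (\<lambda>a b. mpoly_eval (\<lambda>c. [:\<sigma> c:]) (ray a b) g)"
proof -
  note S = is_subfield_range[OF \<sigma>]
  have "quadratic_along_rays (range \<sigma>) (\<lambda>a b. [:\<sigma> k:] * monom_eval (ray a b) m)" for k m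
  proof (cases "Poly_Mapping.keys m \<subseteq> {0, 1, 2}")
    case False
    thus ?thesis using quadratic_along_rays_zero[OF S] by (simp add: monom_eval_ray)
  next
    case True
    have "[:\<sigma> k:] * monom_eval (ray a b) m = monom (\<sigma> k * (a ^ Poly_Mapping.lookup m 0 * b ^ Poly_Mapping.lookup m 1))
        (Poly_Mapping.lookup m 0 + Poly_Mapping.lookup m 1)" for a b
      using True by (simp add: monom_eval_ray smult_monom)
    thus ?thesis by (simp only: quadratic_along_rays_monom[OF S rangeI])
  qed
  thus ?thesis unfolding mpoly_eval_def by (intro quadratic_along_rays_sum[OF S]) simp_all
qed

text \<open>
  Along each ray the form restricts to a polynomial of degree at most four, so each \<open>g j\<close> restricts to one of
  degree at most two in \<open>x\<close> and \<open>y\<close> with coefficients in the image of the field. It vanishes at the two real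
  zeros of the quartic, hence everywhere; but the quartic is \<open>9M\<^sup>2\<close> at the point \<open>(0, 0, 1)\<close>.
\<close>
theorem quartic_not_sum_of_squares:
  assumes \<sigma>: "real_embedding (\<sigma> :: 'k::field_char_0 \<Rightarrow> real)" and u: "0 < u" "u < 2"
    and noroot: "\<forall>r\<in>range \<sigma>. r ^ 3 - 3 * r \<noteq> of_rat u"
  shows "\<not> sum_of_squares_of_forms n (base_change (quartic l (4 * u ^ 2)) :: 'k mpoly)"
proof
  assume "sum_of_squares_of_forms n (base_change (quartic l (4 * u ^ 2)) :: 'k mpoly)"
  then obtain N and g :: "nat \<Rightarrow> 'k mpoly" where g: "base_change (quartic l (4 * u ^ 2)) = (\<Sum>j<N. g j ^ 2)"
    unfolding sum_of_squares_of_forms_def sum_of_N_squares_of_forms_def by blast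
  define U :: real where "U = of_rat u"
  have U: "0 < U" "U < 2" unfolding U_def using u by (simp, metis of_rat_less of_rat_numeral_eq)
  obtain \<rho> h p p' where \<rho>: "\<rho> > 0" "\<rho> ^ 3 - 3 * \<rho> = U" and h: "h ^ 2 = U * \<rho>" "h > 0"
    and rel: "p + p' = 4 * h ^ 2" "h * (p - p') = 4 * U ^ 2" "p * p' = 3 * (4 * U ^ 2)"
    by (rule real_data[OF U])
  define \<phi> where "\<phi> c = [:\<sigma> c:]" for c
  have hom: "\<And>x y. \<phi> (x + y) = \<phi> x + \<phi> y" "\<And>x y. \<phi> (x * y) = \<phi> x * \<phi> y"
    unfolding \<phi>_def by (simp_all add: real_embeddingD[OF \<sigma>])
  define G where "G j a b = mpoly_eval \<phi> (ray a b) (g j)" for j a b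
  define F where "F a b = mpoly_eval \<phi> (ray a b) (base_change (quartic l (4 * u ^ 2)))" for a b
  have FG: "F a b = (\<Sum>j<N. G j a b ^ 2)" for a b
    unfolding F_def G_def g by (simp add: mpoly_eval_sum[OF hom] power2_eq_square mpoly_eval_mult[OF hom])
  let ?M = "4 * U ^ 2"
  have \<phi>M: "\<phi> (of_rat r) = [:of_rat r:]" for r unfolding \<phi>_def by (simp add: real_embedding_of_rat[OF \<sigma>])
  have F: "F a b = monom (a ^ 4) 4 + monom (6 * ?M * a ^ 2 * b) 3 + monom (6 * ?M * a ^ 2) 2 + monom (- 2 * ?M * a * b ^ 3) 4
     + monom (- 12 * ?M * a * b ^ 2) 3 + monom (4 * ?M ^ 2 * a) 1 + monom (3 * ?M * b ^ 4) 4 + monom (- 6 * ?M ^ 2 * b) 1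
     + monom (9 * ?M ^ 2) 0" for a b
    unfolding F_def quartic_def base_change_add base_change_single mpoly_eval_add[OF hom] mpoly_eval_single[OF hom] \<phi>M
    by (simp add: monom_eval_mon3 ray_def monom_power mult_monom smult_monom of_rat_mult of_rat_power of_rat_minus U_def
        mult.assoc monom_0 eval_nat_numeral)
  have degF: "degree (F a b) \<le> 2 * 2" for a b
    unfolding F by (intro degree_add_le order_trans[OF degree_monom_le]) simp_all
  have F1: "poly (F a b) 1 = quartic_fun ?M a b 1" for a b
    unfolding F quartic_fun_def by (simp add: poly_monom)
  have degG: "degree (G j a b) \<le> 2" if "j < N" for j a b
    using degree_sum_of_squares[of "\<lambda>j. G j a b" N 2 j] degF[of a b] that unfolding FG by simp
  have S: "is_subfield (range \<sigma>)" by (rule is_subfield_range[OF \<sigma>])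
  have P: "quartic_fun ?M p (- 2 * h) 1 = 0" "quartic_fun ?M p' (2 * h) 1 = 0"
    by (rule quartic_fun_double_points[OF rel])+
  have vanish: "poly (G j a b) 1 = 0" if j: "j < N" for j a b
  proof -
    have "quadratic_along_rays (range \<sigma>) (G j)"
      unfolding G_def \<phi>_def by (rule quadratic_along_rays_mpoly_eval[OF \<sigma>])
    then obtain c :: "nat \<Rightarrow> real" where c: "\<forall>i. c i \<in> range \<sigma>" and co: "\<forall>a b. coeff (G j a b) 0 = c 0
      \<and> coeff (G j a b) 1 = c 1 * a + c 2 * b \<and> coeff (G j a b) 2 = c 3 * a ^ 2 + c 4 * a * b + c 5 * b ^ 2"
      unfolding quadratic_along_rays_def by (elim exE conjE)
    note c = c[rule_format] and co = co[rule_format]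
    have val: "poly (G j a b) 1 = c 0 + c 1 * a + c 2 * b + c 3 * a ^ 2 + c 4 * a * b + c 5 * b ^ 2" for a b
    proof -
      have "poly (G j a b) 1 = (\<Sum>i\<le>2. coeff (G j a b) i)"
        unfolding poly_altdef using degG[OF j, of a b]
        by (simp add: sum.mono_neutral_left[of "{..2}" "{..degree (G j a b)}"] coeff_eq_0)
      thus ?thesis using co[of a b] by (simp add: numeral_2_eq_2)
    qed
    have zero: "poly (G j a b) 1 = 0" if "quartic_fun ?M a b 1 = 0" for a b
    proof -
      have "(\<Sum>j<N. poly (G j a b) 1 ^ 2) = 0"
        using that F1[of a b] unfolding FG by (simp add: poly_sum)
      thus ?thesis using j by (subst (asm) sum_nonneg_eq_0_iff) auto
    qed
    have "c 0 = 0 \<and> c 1 = 0 \<and> c 2 = 0 \<and> c 3 = 0 \<and> c 4 = 0 \<and> c 5 = 0"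
    proof (rule quadric_vanishing_at_double_points[OF S _ _ _ \<rho>(2) h(1) rel c c c c c c])
      show "\<forall>x\<in>range \<sigma>. x ^ 3 - 3 * x \<noteq> U" using noroot unfolding U_def .
      show "U \<in> range \<sigma>" unfolding U_def by (rule is_subfield_of_rat[OF S])
      show "U \<noteq> 0" using U by simp
    qed (use zero[OF P(1)] zero[OF P(2)] in \<open>simp_all add: val\<close>)
    thus ?thesis unfolding val by simp
  qed
  have "quartic_fun ?M 0 0 1 = 0" unfolding F1[symmetric] FG by (simp add: poly_sum vanish)
  thus False using U by (simp add: quartic_fun_def)
qed

theorem corollary2p11:
  fixes n d :: nat
  assumes "number_field TYPE('k::field_char_0)"
    and "has_real_place TYPE('k)"
    and "n \<ge> 2" and "d \<ge> 4" and "even d"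
  shows "\<exists>f :: rat mpoly. form_of_degree n d f \<and>
           sum_of_N_squares_of_forms n 2 (base_change f :: real mpoly) \<and>
           \<not> sum_of_squares_of_forms n (base_change f :: 'k mpoly)"
proof -
  obtain \<sigma> :: "'k \<Rightarrow> real" where \<sigma>: "real_embedding \<sigma>" using assms(2) unfolding has_real_place_def by blast
  obtain u :: rat where u: "0 < u" "u < 2" "\<forall>r\<in>range \<sigma>. r ^ 3 - 3 * r \<noteq> of_rat u"
    using ex_cubic_without_root[OF assms(1) \<sigma>] by blast
  obtain j where j: "d = 2 * j + 4"
  proof -
    from assms obtain i where "d = 2 * i" by blast
    thus thesis using that[of "i - 2"] assms(4) by simp
  qed
  have U: "0 < (of_rat u :: real)" "(of_rat u :: real) < 2"
    using u by (simp, metis of_rat_less of_rat_numeral_eq)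
  obtain h p p' where rel: "p + p' = 4 * h ^ 2" "h * (p - p') = 4 * (of_rat u) ^ 2" "p * p' = 3 * (4 * (of_rat u) ^ 2)"
    "p - h ^ 2 \<ge> 0" "p' - h ^ 2 \<ge> (0 :: real)"
    by (rule real_data[OF U])
  have "sum_of_N_squares_of_forms n 2 (quartic (2 * j) (4 * of_rat u ^ 2) :: real mpoly)"
    by (rule quartic_sum_of_two_squares[OF assms(3) rel(1-3), of "sqrt (p - h ^ 2)" "sqrt (p' - h ^ 2)"])
      (use rel in auto)
  hence "sum_of_N_squares_of_forms n 2 (base_change (quartic (2 * j) (4 * u ^ 2)) :: real mpoly)"
    unfolding base_change_quartic by (simp add: of_rat_mult of_rat_power)
  thus ?thesis using quartic_not_sum_of_squares[OF \<sigma> u] form_of_degree_quartic[OF assms(3)] j by blast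
qed

end
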